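(* Let $H$ be a real Hilbert space and let $A$ be a linear operator on $H$ that is unitarily equivalent to a non-negative multiplication operator (in the sense specified in the context). Let $t_0$ be a positive real number. Let $a$, $r$, $\alpha$ be real numbers such that $$a>0,\qquad 0\leq r\leq a,\qquad \alpha>1,$$ consider the damping coefficient $$b(t):=\frac{a+r\sin(t^{\alpha})}{t}\qquad\forall t>0,$$ and set $$\mu:=\min\{a,2\},\qquad B:=\frac{3r}{\alpha t_0^{\alpha}},$$ $$\Gamma_2:=\exp\left(a(a+r+8)+\frac{5r(a+r+4)}{2}+\frac{3r}{\alpha t_0^{\alpha}}+\frac{r\log 3}{\alpha-1}\right).$$ Then for every $u_0\in D(A^{1/2})$ and every $u_1\in H$, the solution $u$ to the problem $$u''(t)+b(t)u'(t)+Au(t)=0\quad (t\geq t_0),\qquad u(t_0)=u_0,\quad u'(t_0)=u_1,$$ satisfies $$|u'(t)|^2+|A^{1/2}u(t)|^2\leq \Gamma_2\left(4e^{2B}|u_1|^2+|A^{1/2}u_0|^2+\frac{2}{t_0^2}|u_0|^2\right)\left(\frac{t_0}{t}\right)^{\mu}\qquad\forall t\geq t_0.$$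
   Context: Functional setting. $H$ is a real Hilbert space with norm $|\cdot|$, and $A$ is a linear operator on $H$ with domain $D(A)$, unitarily equivalent to a non-negative multiplication operator: there exist a measure space $(\mathcal{M},\nu)$, a measurable function $\lambda:\mathcal{M}\to[0,+\infty)$ and a surjective linear isometry $\mathscr{F}:H\to L^2(\mathcal{M},\nu)$ (real-valued functions) such that $u\in D(A)$ if and only if $\lambda(\xi)^2[\mathscr{F}u](\xi)\in L^2(\mathcal{M},\nu)$, and $[\mathscr{F}(Au)](\xi)=\lambda(\xi)^2[\mathscr{F}u](\xi)$ for every $u\in D(A)$. Writing $\widehat{u}=\mathscr{F}u$, for $\beta>0$ the space $D(A^{\beta})$ is the set of $u\in H$ with $\int_{\mathcal{M}}\lambda(\xi)^{4\beta}\widehat{u}(\xi)^2\,d\nu(\xi)<+\infty$, and for such $u$ one has $|A^{\beta}u|^2=\int_{\mathcal{M}}\lambda(\xi)^{4\beta}\widehat{u}(\xi)^2\,d\nu(\xi)$. Solutions. If $b\in L^1((t_0,T))$ for every $T>t_0$, the solution of $u''+b(t)u'+Au=0$ with $u(t_0)=u_0\in D(A^{1/2})$, $u'(t_0)=u_1\in H$ is defined as $u(t):=\mathscr{F}^{-1}\widehat{u}(t,\cdot)$, where for each $\xi\in\mathcal{M}$ the function $t\mapsto\widehat{u}(t,\xi)$ solves the ordinary differential equation $\widehat{u}\,''(t,\xi)+b(t)\widehat{u}\,'(t,\xi)+\lambda(\xi)^2\widehat{u}(t,\xi)=0$ (primes are time derivatives), with $\widehat{u}(t_0,\xi)=[\mathscr{F}u_0](\xi)$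 and $\widehat{u}\,'(t_0,\xi)=[\mathscr{F}u_1](\xi)$. This is the unique solution in $C^0([t_0,+\infty),D(A^{1/2}))\cap C^1([t_0,+\infty),H)$. *)

theory Defs
  imports "HOL-Analysis.Analysis"
begin

text \<open>
  Real \<open>L\<^sup>2\<close> functions.  The quotient by almost-everywhere equality is not formed:
  the transform below maps a vector to a representative of its class, and all identities
  between elements of \<open>L\<^sup>2\<close> are required almost everywhere.
\<close>

definition L2_fun :: "'m measure \<Rightarrow> ('m \<Rightarrow> real) set" where
  "L2_fun M = {f. f \<in> borel_measurable M \<and> integrable M (\<lambda>x. (f x)\<^sup>2)}"

locale mult_operator =
  fixes D :: "'h::{real_inner, complete_space} set"
    and A :: "'h \<Rightarrow> 'h"
    and M :: "'m measure"
    and lam :: "'m \<Rightarrow> real"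
    and F :: "'h \<Rightarrow> 'm \<Rightarrow> real"
  assumes dom_subspace: "subspace D"
    and A_add: "\<And>u v. u \<in> D \<Longrightarrow> v \<in> D \<Longrightarrow> A (u + v) = A u + A v"
    and A_scale: "\<And>c u. u \<in> D \<Longrightarrow> A (c *\<^sub>R u) = c *\<^sub>R A u"
    and lam_measurable: "lam \<in> borel_measurable M"
    and lam_nonneg: "\<And>x. x \<in> space M \<Longrightarrow> 0 \<le> lam x"
    and F_L2: "\<And>u. F u \<in> L2_fun M"
    and F_add: "\<And>u v. AE x in M. F (u + v) x = F u x + F v x"
    and F_scale: "\<And>c u. AE x in M. F (c *\<^sub>R u) x = c * F u x"
    and F_isometry: "\<And>u. (norm u)\<^sup>2 = (\<integral>x. (F u x)\<^sup>2 \<partial>M)"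
    and F_surj: "\<And>f. f \<in> L2_fun M \<Longrightarrow> \<exists>u. AE x in M. F u x = f x"
    and dom_iff: "\<And>u. u \<in> D \<longleftrightarrow> (\<lambda>x. (lam x)\<^sup>2 * F u x) \<in> L2_fun M"
    and F_A: "\<And>u. u \<in> D \<Longrightarrow> AE x in M. F (A u) x = (lam x)\<^sup>2 * F u x"

text \<open>
  Domain of \<open>A\<^sup>\<beta>\<close>, and \<open>A\<^sup>\<beta>\<close> itself as the operator that multiplies the transform by
  \<open>lam\<^bsup>2\<beta>\<^esup>\<close>; it is only meaningful on the domain.
\<close>

definition pow_dom :: "'m measure \<Rightarrow> ('m \<Rightarrow> real) \<Rightarrow> ('h \<Rightarrow> 'm \<Rightarrow> real) \<Rightarrow> real \<Rightarrow> 'h set" where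
  "pow_dom M lam F \<beta> = {u. integrable M (\<lambda>x. lam x powr (4 * \<beta>) * (F u x)\<^sup>2)}"

definition op_pow ::
  "'m measure \<Rightarrow> ('m \<Rightarrow> real) \<Rightarrow> ('h \<Rightarrow> 'm \<Rightarrow> real) \<Rightarrow> real \<Rightarrow> 'h \<Rightarrow> 'h" where
  "op_pow M lam F \<beta> u = (THE v. AE x in M. F v x = lam x powr (2 * \<beta>) * F u x)"

lemma (in mult_operator) op_pow:
  assumes "u \<in> pow_dom M lam F \<beta>"
  shows op_pow_transform: "AE x in M. F (op_pow M lam F \<beta> u) x = lam x powr (2 * \<beta>) * F u x"
    and norm_op_pow: "(norm (op_pow M lam F \<beta> u))\<^sup>2 = (\<integral>x. lam x powr (4 * \<beta>) * (F u x)\<^sup>2 \<partial>M)"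
proof -
  have sq: "(lam x powr (2 * \<beta>) * F u x)\<^sup>2 = lam x powr (4 * \<beta>) * (F u x)\<^sup>2" for x
    proof -
    have "(lam x powr (2 * \<beta>))\<^sup>2 = lam x powr (2 * \<beta> + 2 * \<beta>)"
      unfolding power2_eq_square powr_add ..
    then show ?thesis
      by (simp add: power_mult_distrib)
  qed
  have F_meas: "F v \<in> borel_measurable M" for v
    using F_L2[of v] by (simp add: L2_fun_def)
  have "(\<lambda>x. lam x powr (2 * \<beta>) * F u x) \<in> L2_fun M"
    using assms F_meas lam_measurable by (simp add: L2_fun_def sq pow_dom_def)
  from F_surj[OF this] obtain v where v: "AE x in M. F v x = lam x powr (2 * \<beta>) * F u x"
    by blast
  have unique: "w = v" if w: "AE x in M. F w x = lam x powr (2 * \<beta>) * F u x" for w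
  proof -
    have "AE x in M. (F (w + (-1) *\<^sub>R v) x)\<^sup>2 = 0"
      using v w F_add[of w "(-1) *\<^sub>R v"] F_scale[of "-1" v] by eventually_elim simp
    then have "(\<integral>x. (F (w + (-1) *\<^sub>R v) x)\<^sup>2 \<partial>M) = 0"
      by (rule integral_eq_zero_AE)
    then show ?thesis
      using F_isometry[of "w + (-1) *\<^sub>R v"] by simp
  qed
  show *: "AE x in M. F (op_pow M lam F \<beta> u) x = lam x powr (2 * \<beta>) * F u x"
    unfolding op_pow_def
    by (rule theI[where P = "\<lambda>v. AE x in M. F v x = lam x powr (2 * \<beta>) * F u x", OF v unique])
  have "AE x in M. (F (op_pow M lam F \<beta> u) x)\<^sup>2 = lam x powr (4 * \<beta>) * (F u x)\<^sup>2"
    using * by eventually_elim (simp only: sq)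
  then show "(norm (op_pow M lam F \<beta> u))\<^sup>2 = (\<integral>x. lam x powr (4 * \<beta>) * (F u x)\<^sup>2 \<partial>M)"
    unfolding F_isometry by (intro integral_cong_AE) (use F_meas lam_measurable in simp_all)
qed

text \<open>
  Classical solution of \<open>v'' + b v' + l\<^sup>2 v = 0\<close> on \<open>[t0, \<infinity>)\<close> with derivative \<open>v'\<close>
  (one-sided at \<open>t0\<close>).  This is the right notion when \<open>b\<close> is continuous there.
\<close>

definition ode_solution ::
  "(real \<Rightarrow> real) \<Rightarrow> real \<Rightarrow> real \<Rightarrow> real \<Rightarrow> real \<Rightarrow> (real \<Rightarrow> real) \<Rightarrow> (real \<Rightarrow> real) \<Rightarrow> bool" where
  "ode_solution b l t0 v0 v1 v v' \<longleftrightarrow>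
     v t0 = v0 \<and> v' t0 = v1 \<and>
     (\<forall>t\<ge>t0. (v has_real_derivative v' t) (at t within {t0..}) \<and>
       (\<exists>v''. (v' has_real_derivative v'') (at t within {t0..}) \<and>
              v'' + b t * v' t + l\<^sup>2 * v t = 0))"

definition evolution_solution ::
  "'m measure \<Rightarrow> ('m \<Rightarrow> real) \<Rightarrow> ('h \<Rightarrow> 'm \<Rightarrow> real) \<Rightarrow> (real \<Rightarrow> real) \<Rightarrow> real \<Rightarrow> 'h \<Rightarrow> 'h \<Rightarrow>
    (real \<Rightarrow> 'h) \<Rightarrow> bool" where
  "evolution_solution M lam F b t0 u0 u1 u \<longleftrightarrow>
     (\<exists>w w'. (\<forall>x\<in>space M. ode_solution b (lam x) t0 (F u0 x) (F u1 x) (\<lambda>t. w t x) (\<lambda>t. w' t x)) \<and>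
             (\<forall>t\<ge>t0. AE x in M. F (u t) x = w t x))"

end

theory Submission
  imports Defs
begin

text \<open>
  The transform turns the equation into a family of scalar oscillators
  \<open>v'' + b v' + l\<^sup>2 v = 0\<close>, one for each frequency \<open>l = lam x\<close>.  What has to be shown is a decay
  estimate for \<open>v'\<^sup>2 + l\<^sup>2 v\<^sup>2\<close> whose constants do not depend on \<open>l\<close>; it can then be integrated
  over the measure space (\<open>mode_energy_le\<close>).  The two mechanisms of decay are separated by
  \<open>l t = 1/2\<close>.

  While \<open>l t \<le> 1/2\<close> the restoring force is too weak to matter (\<open>low_frequency_energy_le\<close>).  The
  velocity is the freely damped one, of size \<open>(t0/t)\<^sup>a\<close>, up to an error \<open>l\<^sup>2 t sup |v|\<close>.
  Integrating, \<open>sup |v|\<close> is controlled by the data, because the term \<open>l\<^sup>2 t\<^sup>2 / 2 sup |v|\<close> can be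
  absorbed.  The potential part \<open>l\<^sup>2 v\<^sup>2\<close> is small only because \<open>l \<le> 1/(2 t)\<close>, which gives no more
  than the rate \<open>(t0/t)\<^sup>2\<close>: this is the reason for \<open>\<mu> = min a 2\<close>.

  Once \<open>l t \<ge> 1/2\<close> the solution oscillates, kinetic and potential energy are equal on average, and
  the energy decays like \<open>exp (- \<integral> b)\<close>, that is, like \<open>t\<close> to the power \<open>-a\<close>
  (\<open>high_frequency_energy_le\<close>).  With an angle \<open>\<phi>\<close> defined by \<open>v' = \<surd>E cos (\<phi>/2)\<close> and
  \<open>l v = \<surd>E sin (\<phi>/2)\<close> one has \<open>(ln E)' = - b (1 + cos \<phi>)\<close> and \<open>\<phi>' = 2 l + b sin \<phi>\<close>.  Besides
  \<open>- a/t\<close> the right-hand side consists of the terms \<open>a cos \<phi> / t\<close>, \<open>r sin (t\<^sup>\<alpha>) / t\<close> and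
  \<open>(r/2) sin (t\<^sup>\<alpha> \<plusminus> \<phi>) / t\<close>.  Integration by parts bounds the integral of each of them, except
  where the phase \<open>t\<^sup>\<alpha> - \<phi>\<close> is almost stationary, that is, where \<open>\<alpha> t\<^bsup>\<alpha>-1\<^esup>\<close> is close to \<open>2 l\<close>.
  This resonance is confined to \<open>l \<le> \<alpha> t\<^bsup>\<alpha>-1\<^esup> \<le> 3 l\<close>.  The endpoints of that window have the
  ratio \<open>3\<^bsup>1/(\<alpha>-1)\<^esup>\<close>, so that even without any cancellation it contributes at most
  \<open>r ln 3 / (\<alpha> - 1)\<close>.

  The bound of the velocities by one square-integrable function also makes dominated convergence
  applicable to the difference quotients of \<open>u\<close>.  Therefore \<open>u\<close> is differentiable in the Hilbert
  space and its derivative is transformed into \<open>v'\<close> (\<open>has_vector_derivative_of_transform\<close>).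
\<close>

section \<open>Comparison of increments and integrals\<close>

lemma increment_le_of_derivative_le:
  fixes f g :: "real \<Rightarrow> real"
  assumes "x \<le> y" and sub: "{x..y} \<subseteq> S"
    and f: "\<And>s. s \<in> {x..y} \<Longrightarrow> (f has_real_derivative f' s) (at s within S)"
    and g: "\<And>s. s \<in> {x..y} \<Longrightarrow> (g has_real_derivative g' s) (at s within S)"
    and le: "\<And>s. s \<in> {x..y} \<Longrightarrow> f' s \<le> g' s"
  shows "f y - f x \<le> g y - g x"
proof -
  have d: "((\<lambda>s. g s - f s) has_real_derivative g' s - f' s) (at s within {x..y})"
    if "s \<in> {x..y}" for s
    by (rule has_field_derivative_subset[OF DERIV_diff[OF g[OF that] f[OF that]] sub])
  have "g x - f x \<le> g y - f y"
  proof (rule DERIV_nonneg_imp_increasing_open[where f = "\<lambda>s. g s - f s", OF \<open>x \<le> y\<close>])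
    fix s assume s: "x < s" "s < y"
    then have "s \<in> {x..y}" and "at s within {x..y} = at s"
      by (simp_all add: at_within_Icc_at)
    then have "((\<lambda>s. g s - f s) has_real_derivative g' s - f' s) (at s)" "0 \<le> g' s - f' s"
      using d[of s] le[of s] by simp_all
    then show "\<exists>z. ((\<lambda>s. g s - f s) has_real_derivative z) (at s) \<and> 0 \<le> z"
      by blast
  next
    show "continuous_on {x..y} (\<lambda>s. g s - f s)"
      using d by (rule DERIV_continuous_on)
  qed
  then show ?thesis by simp
qed

lemma abs_increment_le_of_abs_derivative_le:
  fixes f g :: "real \<Rightarrow> real"
  assumes "x \<le> y" and sub: "{x..y} \<subseteq> S"
    and f: "\<And>s. s \<in> {x..y} \<Longrightarrow> (f has_real_derivative f' s) (at s within S)"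
    and g: "\<And>s. s \<in> {x..y} \<Longrightarrow> (g has_real_derivative g' s) (at s within S)"
    and le: "\<And>s. s \<in> {x..y} \<Longrightarrow> \<bar>f' s\<bar> \<le> g' s"
  shows "\<bar>f y - f x\<bar> \<le> g y - g x"
proof -
  have "f y - f x \<le> g y - g x"
    by (rule increment_le_of_derivative_le[OF assms(1,2) f g]) (use le in \<open>auto simp: abs_le_iff\<close>)
  moreover have "- f y - - f x \<le> g y - g x"
    by (rule increment_le_of_derivative_le[OF assms(1,2) DERIV_minus[OF f] g])
      (use le in \<open>auto simp: abs_le_iff\<close>)
  ultimately show ?thesis by linarith
qed

lemma integral_le_of_derivative_ge:
  fixes p P :: "real \<Rightarrow> real"
  assumes "x \<le> y" and sub: "{x..y} \<subseteq> S" and p: "continuous_on {x..y} p"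
    and P: "\<And>s. s \<in> {x..y} \<Longrightarrow> (P has_real_derivative P' s) (at s within S)"
    and le: "\<And>s. s \<in> {x..y} \<Longrightarrow> p s \<le> P' s"
  shows "integral {x..y} p \<le> P y - P x"
proof -
  have "(P has_vector_derivative P' s) (at s within {x..y})" if "s \<in> {x..y}" for s
    using has_field_derivative_subset[OF P[OF that] sub]
    by (simp add: has_real_derivative_iff_has_vector_derivative)
  from fundamental_theorem_of_calculus[OF \<open>x \<le> y\<close> this]
  have P': "(P' has_integral P y - P x) {x..y}" .
  then have "integral {x..y} p \<le> integral {x..y} P'"
    by (intro integral_le[OF integrable_continuous_real[OF p] has_integral_integrable le])
  then show ?thesis using P' by (simp add: integral_unique)
qed

section \<open>The damping coefficient\<close>

locale oscillating_damping =
  fixes t0 a r \<alpha> :: real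
  assumes t0: "0 < t0" and a: "0 < a" and r: "0 \<le> r" and r_le: "r \<le> a" and \<alpha>: "1 < \<alpha>"
begin

definition b :: "real \<Rightarrow> real" where
  "b t = (a + r * sin (t powr \<alpha>)) / t"

lemma b_nonneg: "0 < t \<Longrightarrow> 0 \<le> b t"
proof -
  assume "0 < t"
  have "- r \<le> r * sin (t powr \<alpha>)"
    using mult_left_mono[OF sin_ge_minus_one r] by simp
  then show ?thesis unfolding b_def using r_le \<open>0 < t\<close> by simp
qed

lemma b_le: "0 < t \<Longrightarrow> b t \<le> (a + r) / t"
proof -
  assume "0 < t"
  have "r * sin (t powr \<alpha>) \<le> r"
    using mult_left_mono[OF sin_le_one r] by simp
  then show ?thesis unfolding b_def using \<open>0 < t\<close> by (intro divide_right_mono) auto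
qed

text \<open>
  The first term of the integration by parts of \<open>- r sin (t\<^sup>\<alpha>) / t\<close> is
  \<open>r cos (t\<^sup>\<alpha>) / (\<alpha> t\<^sup>\<alpha>)\<close>.  The integrand that is left over is at most \<open>r / t\<^bsup>\<alpha>+1\<^esup>\<close>, the derivative of
  \<open>- r / (\<alpha> t\<^sup>\<alpha>)\<close>; adding this function makes the derivative of the sum a majorant.
\<close>

definition sine_majorant :: "real \<Rightarrow> real" where
  "sine_majorant t = r * (cos (t powr \<alpha>) - 1) / (\<alpha> * t powr \<alpha>)"

definition sine_majorant' :: "real \<Rightarrow> real" where
  "sine_majorant' t = - r * sin (t powr \<alpha>) / t + r * (1 - cos (t powr \<alpha>)) / (t powr \<alpha> * t)"

lemma DERIV_powr_alpha:
  assumes "0 < t"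
  shows "((\<lambda>s. s powr \<alpha>) has_real_derivative \<alpha> * t powr \<alpha> / t) (at t within S)"
  using assms \<alpha> by (auto intro!: derivative_eq_intros simp: powr_diff)

lemma DERIV_cos_powr_alpha:
  assumes "0 < t"
  shows "((\<lambda>s. cos (s powr \<alpha>)) has_real_derivative
    - sin (t powr \<alpha>) * (\<alpha> * t powr \<alpha> / t)) (at t within S)"
  by (rule DERIV_chain2[OF DERIV_cos DERIV_powr_alpha[OF assms]])

lemma DERIV_sin_powr_alpha:
  assumes "0 < t"
  shows "((\<lambda>s. sin (s powr \<alpha>)) has_real_derivative
    cos (t powr \<alpha>) * (\<alpha> * t powr \<alpha> / t)) (at t within S)"
  by (rule DERIV_chain2[OF DERIV_sin DERIV_powr_alpha[OF assms]])

lemma DERIV_sine_majorant: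
  assumes "0 < t"
  shows "(sine_majorant has_real_derivative sine_majorant' t) (at t within S)"
proof -
  have nz: "\<alpha> * t powr \<alpha> \<noteq> 0" using assms \<alpha> by simp
  have "((\<lambda>s. r * (cos (s powr \<alpha>) - 1)) has_real_derivative
      r * (- sin (t powr \<alpha>) * (\<alpha> * t powr \<alpha> / t) - 0)) (at t within S)"
    by (intro DERIV_cmult DERIV_diff DERIV_const DERIV_cos_powr_alpha assms)
  from DERIV_divide[OF this DERIV_cmult[OF DERIV_powr_alpha[OF assms]] nz]
  have "(sine_majorant has_real_derivative
      (r * (- sin (t powr \<alpha>) * (\<alpha> * t powr \<alpha> / t) - 0) * (\<alpha> * t powr \<alpha>)
        - r * (cos (t powr \<alpha>) - 1) * (\<alpha> * (\<alpha> * t powr \<alpha> / t)))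
      / ((\<alpha> * t powr \<alpha>) * (\<alpha> * t powr \<alpha>))) (at t within S)" (is "(_ has_real_derivative ?d) _")
    unfolding sine_majorant_def .
  moreover have "?d = sine_majorant' t"
    unfolding sine_majorant'_def using assms \<alpha>
    by (simp add: divide_simps) (auto simp: algebra_simps)
  ultimately show ?thesis by (simp only:)
qed

lemma sine_majorant'_ge: "0 < t \<Longrightarrow> - r * sin (t powr \<alpha>) / t \<le> sine_majorant' t"
  using r unfolding sine_majorant'_def by simp

lemma sine_majorant_increment_le:
  assumes "0 < x"
  shows "sine_majorant y - sine_majorant x \<le> 2 * r / (\<alpha> * x powr \<alpha>)"
proof -
  have "sine_majorant y \<le> 0"
    unfolding sine_majorant_def using r \<alpha>
    by (intro divide_nonpos_nonneg mult_nonneg_nonpos) auto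
  moreover have "-2 \<le> cos (x powr \<alpha>) - 1"
    using cos_ge_minus_one[of "x powr \<alpha>"] by linarith
  then have "(r * (-2)) / (\<alpha> * x powr \<alpha>) \<le> sine_majorant x"
    unfolding sine_majorant_def using r \<alpha> \<open>-2 \<le> cos (x powr \<alpha>) - 1\<close>
    by (intro divide_right_mono mult_left_mono) auto
  ultimately show ?thesis by simp
qed

end

section \<open>Energy of a single mode\<close>

locale damped_mode = oscillating_damping +
  fixes l :: real and v v' :: "real \<Rightarrow> real"
  assumes l: "0 \<le> l"
    and v_deriv: "\<And>t. t0 \<le> t \<Longrightarrow> (v has_real_derivative v' t) (at t within {t0..})"
    and v'_deriv: "\<And>t. t0 \<le> t \<Longrightarrow>
      (v' has_real_derivative - (b t * v' t + l\<^sup>2 * v t)) (at t within {t0..})"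
begin

definition energy :: "real \<Rightarrow> real" where
  "energy t = (v' t)\<^sup>2 + l\<^sup>2 * (v t)\<^sup>2"

lemma energy_nonneg: "0 \<le> energy t"
  unfolding energy_def by simp

lemma DERIV_energy:
  "t0 \<le> t \<Longrightarrow> (energy has_real_derivative - 2 * b t * (v' t)\<^sup>2) (at t within {t0..})"
  unfolding energy_def
  by (auto intro!: derivative_eq_intros v_deriv v'_deriv simp: algebra_simps power2_eq_square)

lemma energy_antimono:
  assumes "t0 \<le> x" "x \<le> y"
  shows "energy y \<le> energy x"
proof -
  have "energy y - energy x \<le> 0 - (0::real)"
  proof (rule increment_le_of_derivative_le[where S = "{t0..}" and f = energy
        and g = "\<lambda>_. 0" and g' = "\<lambda>_. 0"])
    fix s assume "s \<in> {x..y}"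
    with assms have s: "t0 \<le> s" "0 < s" using t0 by auto
    show "(energy has_real_derivative - 2 * b s * (v' s)\<^sup>2) (at s within {t0..})"
      using DERIV_energy s by blast
    show "- 2 * b s * (v' s)\<^sup>2 \<le> 0"
      using b_nonneg[OF \<open>0 < s\<close>] by simp
  qed (use assms in auto)
  then show ?thesis by simp
qed

section \<open>Low frequencies\<close>

text \<open>
  Variation of constants: with an antiderivative \<open>\<beta>\<close> of the damping, \<open>v' exp \<beta>\<close> has the
  derivative \<open>- l\<^sup>2 v exp \<beta>\<close>.  Since \<open>\<beta>\<close> is nondecreasing, the factor \<open>exp (\<beta> s - \<beta> t)\<close> in front of
  the force at time \<open>s\<close> can be replaced by 1, and \<open>sine_majorant\<close> bounds the oscillating part of \<open>\<beta>\<close>.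
\<close>

lemma velocity_le:
  assumes "t0 \<le> t" and V: "\<And>s. s \<in> {t0..t} \<Longrightarrow> \<bar>v s\<bar> \<le> V"
  shows "\<bar>v' t\<bar> \<le> \<bar>v' t0\<bar> * exp (2 * r / (\<alpha> * t0 powr \<alpha>)) * (t0 / t) powr a + l\<^sup>2 * V * t"
proof -
  have "continuous_on {t0..t} b"
    unfolding b_def using t0 by (intro continuous_intros) auto
  then obtain \<beta> where \<beta>0: "\<And>s. s \<in> {t0..t} \<Longrightarrow> (\<beta> has_vector_derivative b s) (at s within {t0..t})"
    using antiderivative_continuous[of t0 t b] by blast
  then have \<beta>: "\<And>s. s \<in> {t0..t} \<Longrightarrow> (\<beta> has_real_derivative b s) (at s within {t0..t})"
    by (simp add: has_real_derivative_iff_has_vector_derivative)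
  have pos: "0 < t" "t0 \<in> {t0..t}" using t0 assms by auto
  have mono: "\<beta> s \<le> \<beta> t" if "s \<in> {t0..t}" for s
  proof -
    have "(0::real) - 0 \<le> \<beta> t - \<beta> s"
      by (rule increment_le_of_derivative_le[where S = "{t0..t}" and f = "\<lambda>_. 0"
          and f' = "\<lambda>_. 0" and g = \<beta> and g' = b and x = s and y = t])
        (use that \<beta> t0 b_nonneg in auto)
    then show ?thesis by simp
  qed
  have "(a * ln t - sine_majorant t) - (a * ln t0 - sine_majorant t0) \<le> \<beta> t - \<beta> t0"
  proof (rule increment_le_of_derivative_le[where S = "{t0..t}"])
    fix s assume s: "s \<in> {t0..t}"
    then have "0 < s" using t0 by auto
    show "((\<lambda>s. a * ln s - sine_majorant s) has_real_derivative a / s - sine_majorant' s)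
        (at s within {t0..t})"
      using \<open>0 < s\<close> by (auto intro!: derivative_eq_intros DERIV_sine_majorant)
    show "(\<beta> has_real_derivative b s) (at s within {t0..t})" using \<beta> s .
    show "a / s - sine_majorant' s \<le> b s"
      using sine_majorant'_ge[OF \<open>0 < s\<close>] by (simp add: b_def add_divide_distrib)
  qed (use assms in auto)
  then have "a * ln (t0 / t) + 2 * r / (\<alpha> * t0 powr \<alpha>) \<ge> - (\<beta> t - \<beta> t0)"
    using sine_majorant_increment_le[OF t0, of t] t0 pos by (simp add: ln_div algebra_simps)
  then have decay: "exp (- (\<beta> t - \<beta> t0)) \<le> exp (2 * r / (\<alpha> * t0 powr \<alpha>)) * (t0 / t) powr a"
    using t0 pos by (simp add: powr_def exp_add[symmetric] add.commute)
  define k where "k = l\<^sup>2 * V * exp (\<beta> t)"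
  have V0: "0 \<le> V" using V[OF pos(2)] by linarith
  have "\<bar>v' t * exp (\<beta> t) - v' t0 * exp (\<beta> t0)\<bar> \<le> k * t - k * t0"
  proof (rule abs_increment_le_of_abs_derivative_le[where S = "{t0..t}" and g' = "\<lambda>_. k"])
    fix s assume s: "s \<in> {t0..t}"
    have v's: "(v' has_real_derivative - (b s * v' s + l\<^sup>2 * v s)) (at s within {t0..t})"
      using v'_deriv[of s] s by (auto intro: has_field_derivative_subset)
    show "((\<lambda>s. v' s * exp (\<beta> s)) has_real_derivative - l\<^sup>2 * v s * exp (\<beta> s)) (at s within {t0..t})"
      by (auto intro!: derivative_eq_intros v's \<beta> s simp: algebra_simps)
    show "\<bar>- l\<^sup>2 * v s * exp (\<beta> s)\<bar> \<le> k"
      unfolding k_def abs_mult using V[OF s] mono[OF s] V0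
      by (auto intro!: mult_mono)
    show "((\<lambda>s. k * s) has_real_derivative k) (at s within {t0..t})"
      by (auto intro!: derivative_eq_intros)
  qed (use assms in auto)
  also have "\<dots> \<le> l\<^sup>2 * V * t * exp (\<beta> t)"
    using t0 V0 by (simp add: k_def mult_ac)
  finally have "\<bar>v' t * exp (\<beta> t)\<bar> \<le> \<bar>v' t0\<bar> * exp (\<beta> t0) + l\<^sup>2 * V * t * exp (\<beta> t)"
    using abs_mult[of "v' t0" "exp (\<beta> t0)"] by simp
  then have "\<bar>v' t\<bar> * exp (\<beta> t) \<le> (\<bar>v' t0\<bar> * exp (- (\<beta> t - \<beta> t0)) + l\<^sup>2 * V * t) * exp (\<beta> t)"
    by (simp add: abs_mult algebra_simps exp_diff)
  then have "\<bar>v' t\<bar> \<le> \<bar>v' t0\<bar> * exp (- (\<beta> t - \<beta> t0)) + l\<^sup>2 * V * t"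
    by simp
  also have "\<dots> \<le> \<bar>v' t0\<bar> * (exp (2 * r / (\<alpha> * t0 powr \<alpha>)) * (t0 / t) powr a) + l\<^sup>2 * V * t"
    using decay by (intro add_right_mono mult_left_mono) auto
  finally show ?thesis by (simp add: mult.assoc)
qed

end

text \<open>
  The integral over \<open>{t0..t}\<close> of \<open>(t0/s)\<^sup>a\<close> is at most \<open>t (t0/t)\<^bsup>\<mu>/2\<^esup>\<close>, uniformly in \<open>a\<close>, even
  though the antiderivative degenerates at \<open>a = 1\<close>.  This is the pointwise form of the Hoelder
  inequality between \<open>1\<close> and \<open>s\<^bsup>-2\<^esup>\<close> that proves it: after extracting \<open>(t0/t)\<^bsup>\<mu>/2\<^esup>\<close>, Young's
  inequality leaves an integrand whose antiderivative is elementary.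
\<close>

lemma powr_decay_le_average:
  fixes a \<mu> s t t0 :: real
  assumes "0 < t0" "t0 \<le> s" "s \<le> t" "0 \<le> \<mu>" "\<mu> \<le> 2" "\<mu> \<le> a"
  shows "(t0 / s) powr a \<le> (t0 / t) powr (\<mu>/2) * ((1 - \<mu>/2) + \<mu>/2 * (t * t0 / s\<^sup>2))"
proof -
  have pos: "0 < s" "0 < t" using assms by auto
  have "(t0 / s) powr a \<le> (t0 / s) powr \<mu>"
    using assms pos by (intro powr_mono') auto
  also have "\<dots> = (t0 / t * (t * t0 / s\<^sup>2)) powr (\<mu>/2)"
  proof -
    have "t0 / t * (t * t0 / s\<^sup>2) = (t0/s) powr 2"
      using pos assms by (simp add: power2_eq_square)
    then show ?thesis using assms pos by (simp only: powr_powr) simp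
  qed
  also have "\<dots> = (t0 / t) powr (\<mu>/2) * (t * t0 / s\<^sup>2) powr (\<mu>/2)"
    using assms pos by (intro powr_mult)
  also have "(t * t0 / s\<^sup>2) powr (\<mu>/2) \<le> (1 - \<mu>/2) + \<mu>/2 * (t * t0 / s\<^sup>2)"
    using Youngs_inequality_0[of "1 - \<mu>/2" "\<mu>/2" 1 "t * t0 / s\<^sup>2"] assms pos by simp
  finally show ?thesis by (simp add: mult_left_mono)
qed

context damped_mode
begin

text \<open>
  Let \<open>V\<close> be the maximum of \<open>|v|\<close> on \<open>{t0..t}\<close>, and let \<open>X\<close>, \<open>Y\<close> and \<open>W\<close> be the scaled data and the
  square root of the expected rate.  Integrating the bound for the velocity gives
  \<open>V \<le> |v t0| + X W t + l\<^sup>2 t\<^sup>2 V / 2\<close>.  As \<open>l\<^sup>2 t\<^sup>2 \<le> 1/4\<close>, the last term is at most \<open>V/8\<close> and is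
  absorbed, so \<open>V \<le> 8/7 W (X + Y) t\<close>; both parts of the energy are then estimated by \<open>V\<close> and \<open>X W\<close>.
\<close>

lemma low_frequency_energy_le:
  assumes t: "t0 \<le> t" and low: "l * t \<le> 1/2"
    and \<mu>: "\<mu> = min a 2"
  shows "energy t \<le> (4 * exp (4 * r / (\<alpha> * t0 powr \<alpha>)) * (v' t0)\<^sup>2 + 2 / t0\<^sup>2 * (v t0)\<^sup>2)
    * (t0 / t) powr \<mu>"
proof -
  have pos: "0 < t" using t t0 by simp
  have \<mu>': "0 \<le> \<mu>" "\<mu> \<le> 2" "\<mu> \<le> a" using \<mu> a by auto
  define W where "W = (t0 / t) powr (\<mu>/2)"
  define X where "X = \<bar>v' t0\<bar> * exp (2 * r / (\<alpha> * t0 powr \<alpha>))"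
  define Y where "Y = \<bar>v t0\<bar> / t0"
  have nn: "0 \<le> W" "0 \<le> X" "0 \<le> Y" unfolding W_def X_def Y_def using t0 by auto
  have "continuous_on {t0..} v"
    using v_deriv by (intro DERIV_continuous_on) auto
  then have "continuous_on {t0..t} (\<lambda>s. \<bar>v s\<bar>)"
    by (intro continuous_intros) (auto intro: continuous_on_subset)
  then obtain s1 where s1: "s1 \<in> {t0..t}" "\<And>s. s \<in> {t0..t} \<Longrightarrow> \<bar>v s\<bar> \<le> \<bar>v s1\<bar>"
    using continuous_attains_sup[of "{t0..t}" "\<lambda>s. \<bar>v s\<bar>"] t by auto
  define V where "V = \<bar>v s1\<bar>"
  have V0: "0 \<le> V" by (simp add: V_def)
  have l2: "l\<^sup>2 * t\<^sup>2 \<le> 1/4"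
    using power_mono[OF low, of 2] l pos by (simp add: power_mult_distrib power_divide)
  have v'_le: "\<bar>v' s\<bar> \<le> X * (t0 / s) powr a + l\<^sup>2 * V * s" if "s \<in> {t0..t}" for s
    unfolding X_def V_def by (rule velocity_le) (use that s1 in auto)
  \<comment> \<open>\<open>G\<close> is an antiderivative of a majorant of \<open>|v'|\<close>; between \<open>t0\<close> and \<open>t\<close> the bracket after \<open>W\<close> grows by exactly \<open>t - t0\<close>.\<close>
  define G where "G s = X * (W * ((1 - \<mu>/2) * s - \<mu>/2 * (t * t0 / s))) + l\<^sup>2 * V * s\<^sup>2 / 2" for s
  define G' where "G' s = X * (W * ((1 - \<mu>/2) + \<mu>/2 * (t * t0 / s\<^sup>2))) + l\<^sup>2 * V * s" for s
  have G: "(G has_real_derivative G' s) (at s within S)" if "0 < s" for s S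
    unfolding G_def G'_def using that
    by (auto intro!: derivative_eq_intros simp: power2_eq_square)
  have G'_ge: "X * (t0 / s) powr a + l\<^sup>2 * V * s \<le> G' s" if "s \<in> {t0..t}" for s
    unfolding G'_def W_def using that t0 \<mu>' nn
    by (intro add_right_mono mult_left_mono powr_decay_le_average) auto
  \<comment> \<open>The maximum may be attained before \<open>t\<close>; monotonicity of \<open>G\<close> carries the estimate to \<open>t\<close>.\<close>
  have "\<bar>v s1 - v t0\<bar> \<le> G s1 - G t0"
  proof (rule abs_increment_le_of_abs_derivative_le[where S = "{t0..}"])
    fix s assume s: "s \<in> {t0..s1}"
    then show "(v has_real_derivative v' s) (at s within {t0..})" using v_deriv by auto
    show "(G has_real_derivative G' s) (at s within {t0..})" using G s t0 by auto
    show "\<bar>v' s\<bar> \<le> G' s" using v'_le[of s] G'_ge[of s] s s1 by auto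
  qed (use s1 in auto)
  moreover have "(0::real) - 0 \<le> G t - G s1"
  proof (rule increment_le_of_derivative_le[where S = "{t0..}" and f = "\<lambda>_. 0"
        and f' = "\<lambda>_. 0" and g = G and g' = G'])
    fix s assume s: "s \<in> {s1..t}"
    then have s': "s \<in> {t0..t}" using s1 by auto
    show "(G has_real_derivative G' s) (at s within {t0..})" using G s' t0 by auto
    show "0 \<le> G' s" using v'_le[OF s'] G'_ge[OF s'] by linarith
  qed (use s1 in auto)
  ultimately have "\<bar>v s1 - v t0\<bar> \<le> G t - G t0" by linarith
  also have "G t - G t0 = X * W * (t - t0) + l\<^sup>2 * V * (t\<^sup>2 - t0\<^sup>2) / 2"
    unfolding G_def using t0 pos by (simp add: field_simps)
  also have "\<dots> \<le> X * W * t + l\<^sup>2 * V * t\<^sup>2 / 2"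
    using nn t0 V0 by (intro add_mono divide_right_mono mult_left_mono) auto
  also have "\<dots> \<le> X * W * t + V / 8"
    using mult_right_mono[OF l2 V0] by (simp add: mult_ac)
  finally have "V \<le> \<bar>v t0\<bar> + X * W * t + V / 8" unfolding V_def by linarith
  moreover have "\<bar>v t0\<bar> \<le> Y * W * t"
  proof -
    have "(t0 / t) powr 1 \<le> W"
      unfolding W_def using t0 t pos \<mu>' by (intro powr_mono') auto
    then have "t0 \<le> W * t" using t0 pos by (simp add: field_simps)
    then have "Y * t0 \<le> Y * (W * t)" using nn by (intro mult_left_mono)
    then show ?thesis unfolding Y_def using t0 by simp
  qed
  ultimately have V_le: "V \<le> 8/7 * (W * (X + Y)) * t" by (simp add: algebra_simps)
  have "l * V \<le> 4/7 * (W * (X + Y))"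
  proof -
    have "l * V \<le> l * (8/7 * (W * (X + Y)) * t)" using V_le l by (rule mult_left_mono)
    also have "\<dots> = (l * t) * (8/7 * (W * (X + Y)))" by simp
    also have "\<dots> \<le> 1/2 * (8/7 * (W * (X + Y)))"
      using low nn by (intro mult_right_mono) auto
    finally show ?thesis by simp
  qed
  moreover have "\<bar>v t\<bar> \<le> V" unfolding V_def using s1 t by auto
  ultimately have "l * \<bar>v t\<bar> \<le> 4/7 * (W * (X + Y))"
    using mult_left_mono[of "\<bar>v t\<bar>" V l] l by linarith
  then have pot: "l\<^sup>2 * (v t)\<^sup>2 \<le> (4/7 * (W * (X + Y)))\<^sup>2"
    using power_mono[of "l * \<bar>v t\<bar>" _ 2] l by (simp add: power_mult_distrib)
  have "l\<^sup>2 * V * t \<le> 2/7 * (W * (X + Y))"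
  proof -
    have "l\<^sup>2 * V * t \<le> l\<^sup>2 * (8/7 * (W * (X + Y)) * t) * t"
      using V_le l pos by (intro mult_left_mono mult_right_mono) auto
    also have "\<dots> = (l\<^sup>2 * t\<^sup>2) * (8/7 * (W * (X + Y)))" by (simp add: power2_eq_square)
    also have "\<dots> \<le> 1/4 * (8/7 * (W * (X + Y)))"
      using l2 nn by (intro mult_right_mono) auto
    finally show ?thesis by simp
  qed
  moreover have "X * (t0 / t) powr a \<le> X * W"
    unfolding W_def using nn t0 t pos \<mu>' by (intro mult_left_mono powr_mono') auto
  ultimately have "\<bar>v' t\<bar> \<le> W * X + 2/7 * (W * (X + Y))"
    using v'_le[of t] t by (simp add: mult.commute)
  then have kin: "(v' t)\<^sup>2 \<le> (W * X + 2/7 * (W * (X + Y)))\<^sup>2"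
    using power_mono[of "\<bar>v' t\<bar>" _ 2] by simp
  have "energy t \<le> (W * X + 2/7 * (W * (X + Y)))\<^sup>2 + (4/7 * (W * (X + Y)))\<^sup>2"
    unfolding energy_def using pot kin by linarith
  also have "\<dots> = W\<^sup>2 * ((X + 2/7 * (X + Y))\<^sup>2 + (4/7 * (X + Y))\<^sup>2)"
    by algebra
  also have "\<dots> \<le> W\<^sup>2 * (4 * X\<^sup>2 + 2 * Y\<^sup>2)"
  proof (rule mult_left_mono)
    \<comment> \<open>The difference of the two sides, with its mixed term \<open>- 68/49 X Y\<close> completed to a square.\<close>
    have "0 \<le> 34/49 * (X - Y)\<^sup>2 + 65/49 * X\<^sup>2 + 44/49 * Y\<^sup>2" by simp
    also have "\<dots> = (4 * X\<^sup>2 + 2 * Y\<^sup>2) - ((X + 2/7 * (X + Y))\<^sup>2 + (4/7 * (X + Y))\<^sup>2)"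
      by (simp add: power2_eq_square field_simps)
    finally show "(X + 2/7 * (X + Y))\<^sup>2 + (4/7 * (X + Y))\<^sup>2 \<le> 4 * X\<^sup>2 + 2 * Y\<^sup>2" by simp
  qed simp
  also have "W\<^sup>2 = (t0 / t) powr \<mu>"
    unfolding W_def power2_eq_square powr_add[symmetric] by simp
  also have "X\<^sup>2 = exp (4 * r / (\<alpha> * t0 powr \<alpha>)) * (v' t0)\<^sup>2"
    using exp_double[of "2 * r / (\<alpha> * t0 powr \<alpha>)"]
    by (simp add: X_def power_mult_distrib mult.commute)
  also have "Y\<^sup>2 = (v t0)\<^sup>2 / t0\<^sup>2"
    unfolding Y_def by (simp add: power_divide)
  finally show ?thesis by (simp add: mult_ac)
qed

section \<open>The phase of an oscillating mode\<close>

text \<open>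
  Cosine and sine of the angle \<open>\<phi>\<close>, twice the polar angle of \<open>(v', l v)\<close>.  Expressing everything
  through these two functions avoids choosing a continuous branch of the angle; the equation
  \<open>\<phi>' = 2 l + b sin \<phi>\<close> is contained in the derivatives of both.
\<close>

definition phase_cos :: "real \<Rightarrow> real" where
  "phase_cos t = ((v' t)\<^sup>2 - l\<^sup>2 * (v t)\<^sup>2) / energy t"

definition phase_sin :: "real \<Rightarrow> real" where
  "phase_sin t = 2 * l * v t * v' t / energy t"

lemma phase_circle: "0 < energy t \<Longrightarrow> (phase_cos t)\<^sup>2 + (phase_sin t)\<^sup>2 = 1"
proof -
  assume e: "0 < energy t"
  have "((v' t)\<^sup>2 - l\<^sup>2 * (v t)\<^sup>2)\<^sup>2 + (2 * l * v t * v' t)\<^sup>2 = (energy t)\<^sup>2"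
    unfolding energy_def by algebra
  then show ?thesis
    unfolding phase_cos_def phase_sin_def using e
    by (simp add: power_divide add_divide_distrib[symmetric])
qed

lemma abs_phase_cos_le: "0 < energy t \<Longrightarrow> \<bar>phase_cos t\<bar> \<le> 1"
  using phase_circle[of t] by (simp add: abs_le_square_iff[of _ 1, simplified])
    (smt (verit) zero_le_power2)

lemma abs_phase_sin_le: "0 < energy t \<Longrightarrow> \<bar>phase_sin t\<bar> \<le> 1"
  using phase_circle[of t] by (simp add: abs_le_square_iff[of _ 1, simplified])
    (smt (verit) zero_le_power2)

lemma DERIV_phase_cos:
  assumes t: "t0 \<le> t" and e: "0 < energy t"
  shows "(phase_cos has_real_derivative - (2 * l + b t * phase_sin t) * phase_sin t) (at t within {t0..})"
proof -
  have num: "((\<lambda>s. (v' s)\<^sup>2 - l\<^sup>2 * (v s)\<^sup>2) has_real_derivative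
      - (2 * b t * (v' t)\<^sup>2 + 4 * l\<^sup>2 * v t * v' t)) (at t within {t0..})"
    by (auto intro!: derivative_eq_intros v_deriv v'_deriv t simp: algebra_simps power2_eq_square)
  have "- (2 * b t * (v' t)\<^sup>2 + 4 * l\<^sup>2 * v t * v' t) * energy t
      - ((v' t)\<^sup>2 - l\<^sup>2 * (v t)\<^sup>2) * (- 2 * b t * (v' t)\<^sup>2)
    = - (2 * l * (2 * l * v t * v' t) * energy t + b t * (2 * l * v t * v' t)\<^sup>2)"
    unfolding energy_def by algebra
  then have "(- (2 * b t * (v' t)\<^sup>2 + 4 * l\<^sup>2 * v t * v' t) * energy t
      - ((v' t)\<^sup>2 - l\<^sup>2 * (v t)\<^sup>2) * (- 2 * b t * (v' t)\<^sup>2)) / (energy t * energy t)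
    = - (2 * l * (2 * l * v t * v' t) * energy t + b t * (2 * l * v t * v' t)\<^sup>2)
        / (energy t * energy t)"
    by (simp only:)
  also have "\<dots> = - (2 * l + b t * phase_sin t) * phase_sin t"
    unfolding phase_sin_def using e by (simp add: field_simps power2_eq_square)
  finally show ?thesis
    using DERIV_divide[OF num DERIV_energy[OF t]] e unfolding phase_cos_def by simp
qed

lemma DERIV_phase_sin:
  assumes t: "t0 \<le> t" and e: "0 < energy t"
  shows "(phase_sin has_real_derivative (2 * l + b t * phase_sin t) * phase_cos t) (at t within {t0..})"
proof -
  have num: "((\<lambda>s. 2 * l * v s * v' s) has_real_derivative
      2 * l * ((v' t)\<^sup>2 - l\<^sup>2 * (v t)\<^sup>2 - b t * v t * v' t)) (at t within {t0..})"
    by (auto intro!: derivative_eq_intros v_deriv v'_deriv t simp: algebra_simps power2_eq_square)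
  have "2 * l * ((v' t)\<^sup>2 - l\<^sup>2 * (v t)\<^sup>2 - b t * v t * v' t) * energy t
      - 2 * l * v t * v' t * (- 2 * b t * (v' t)\<^sup>2)
    = (2 * l * energy t + b t * (2 * l * v t * v' t)) * ((v' t)\<^sup>2 - l\<^sup>2 * (v t)\<^sup>2)"
    unfolding energy_def by algebra
  then have "(2 * l * ((v' t)\<^sup>2 - l\<^sup>2 * (v t)\<^sup>2 - b t * v t * v' t) * energy t
      - 2 * l * v t * v' t * (- 2 * b t * (v' t)\<^sup>2)) / (energy t * energy t)
    = (2 * l + b t * phase_sin t) * phase_cos t"
    unfolding phase_sin_def phase_cos_def using e by (simp add: field_simps)
  then show ?thesis
    using DERIV_divide[OF num DERIV_energy[OF t]] e unfolding phase_sin_def by simp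
qed

lemma abs_b_le: "t0 \<le> t \<Longrightarrow> \<bar>b t\<bar> \<le> (a + r) / t"
  using b_nonneg[of t] b_le[of t] t0 by auto

lemma DERIV_ln_energy:
  assumes t: "t0 \<le> t" and e: "0 < energy t"
  shows "((\<lambda>s. ln (energy s)) has_real_derivative - b t * (1 + phase_cos t)) (at t within {t0..})"
proof -
  have "((\<lambda>s. ln (energy s)) has_real_derivative 1 / energy t * (- 2 * b t * (v' t)\<^sup>2)) (at t within {t0..})"
    by (rule DERIV_chain2[OF DERIV_ln_divide[OF e] DERIV_energy[OF t]])
  moreover have "energy t * (1 + phase_cos t) = energy t + ((v' t)\<^sup>2 - l\<^sup>2 * (v t)\<^sup>2)"
    unfolding phase_cos_def using e by (simp add: field_simps)
  then have "2 * (v' t)\<^sup>2 = energy t * (1 + phase_cos t)"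
    by (simp add: energy_def)
  then have "1 / energy t * (- b t * (2 * (v' t)\<^sup>2)) = - b t * (1 + phase_cos t)"
    using e by (simp only:) simp
  ultimately show ?thesis by (simp add: mult_ac)
qed

lemma continuous_on_phase:
  assumes "t0 \<le> x" "\<And>s. s \<in> {x..y} \<Longrightarrow> 0 < energy s"
  shows "continuous_on {x..y} phase_cos" "continuous_on {x..y} phase_sin"
proof -
  have sub: "{x..y} \<subseteq> {t0..}" using assms by auto
  show "continuous_on {x..y} phase_cos"
    by (rule DERIV_continuous_on, rule has_field_derivative_subset[OF DERIV_phase_cos sub])
      (use assms in auto)
  show "continuous_on {x..y} phase_sin"
    by (rule DERIV_continuous_on, rule has_field_derivative_subset[OF DERIV_phase_sin sub])
      (use assms in auto)
qed

text \<open>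
  From \<open>(sin \<phi>)' = (2 l + b sin \<phi>) cos \<phi>\<close>, integration by parts of \<open>- cos \<phi> / s\<close> yields
  \<open>- sin \<phi> / (2 l s)\<close> and integrands of size at most \<open>(1 + a + r) / (2 l s\<^sup>2)\<close>, which the second
  term of the primitive \<open>P\<close> absorbs.
\<close>

lemma integral_phase_cos_le:
  assumes x: "t0 \<le> x" "x \<le> y" and e: "\<And>s. s \<in> {x..y} \<Longrightarrow> 0 < energy s" and "0 < l"
  shows "integral {x..y} (\<lambda>s. - phase_cos s / s) \<le> (a + r + 2) / (2 * l * x)"
proof -
  define P where "P s = - (phase_sin s + (1 + a + r)) / (2 * l * s)" for s
  define P' where "P' s = (- ((2 * l + b s * phase_sin s) * phase_cos s) * s + (phase_sin s + (1 + a + r)))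
    / (2 * l * s\<^sup>2)" for s
  have "integral {x..y} (\<lambda>s. - phase_cos s / s) \<le> P y - P x"
  proof (rule integral_le_of_derivative_ge[where S = "{t0..}" and P' = P'])
    fix s assume s: "s \<in> {x..y}"
    then have pos: "0 < s" "t0 \<le> s" using x t0 by auto
    show "(P has_real_derivative P' s) (at s within {t0..})"
      unfolding P_def P'_def using pos \<open>0 < l\<close> e[OF s]
      by (auto intro!: derivative_eq_intros DERIV_phase_sin simp: field_simps power2_eq_square)
    have "\<bar>b s * phase_sin s * phase_cos s\<bar> \<le> (a + r) / s * 1 * 1"
      unfolding abs_mult
      by (intro mult_mono abs_b_le abs_phase_sin_le abs_phase_cos_le) (use pos e s in \<open>auto simp: a r less_imp_le\<close>)
    then have "b s * phase_sin s * phase_cos s * s \<le> a + r"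
      using pos by (simp add: field_simps abs_le_iff)
    moreover have "- 1 \<le> phase_sin s" using abs_phase_sin_le[OF e[OF s]] by linarith
    ultimately have "0 \<le> - (b s * phase_sin s * phase_cos s) * s + (phase_sin s + (1 + a + r))" by simp
    then have "- (2 * l * s * phase_cos s) / (2 * l * s\<^sup>2) \<le> P' s"
      unfolding P'_def using \<open>0 < l\<close> by (intro divide_right_mono) (auto simp: algebra_simps)
    then show "- phase_cos s / s \<le> P' s"
      using \<open>0 < l\<close> pos by (simp add: power2_eq_square)
  qed (use x t0 e in \<open>auto intro!: continuous_intros continuous_on_phase\<close>)
  also have "\<dots> \<le> (a + r + 2) / (2 * l * x)"
  proof -
    have "P y \<le> 0"
      unfolding P_def using abs_phase_sin_le[OF e[of y]] x a r t0 \<open>0 < l\<close>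
      by (intro divide_nonpos_pos) auto
    moreover have "- P x \<le> (a + r + 2) / (2 * l * x)"
      unfolding P_def minus_divide_left
      using abs_phase_sin_le[OF e[of x]] x a r t0 \<open>0 < l\<close> by (intro divide_right_mono) auto
    ultimately show ?thesis by linarith
  qed
  finally show ?thesis .
qed

section \<open>Beats between damping and oscillation\<close>

text \<open>
  For \<open>\<sigma> = 1\<close> and \<open>\<sigma> = -1\<close> these are the sine and the cosine of \<open>t\<^sup>\<alpha> + \<sigma> \<phi>\<close>.  They arise
  because \<open>sin (t\<^sup>\<alpha>) cos \<phi>\<close> is half the sum of the sines for the two signs.
\<close>

definition beat_sin :: "real \<Rightarrow> real \<Rightarrow> real" where
  "beat_sin \<sigma> t = sin (t powr \<alpha>) * phase_cos t + \<sigma> * cos (t powr \<alpha>) * phase_sin t"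

definition beat_cos :: "real \<Rightarrow> real \<Rightarrow> real" where
  "beat_cos \<sigma> t = cos (t powr \<alpha>) * phase_cos t - \<sigma> * sin (t powr \<alpha>) * phase_sin t"

lemma beat_circle:
  assumes "0 < energy t" "\<sigma>\<^sup>2 = 1"
  shows "(beat_sin \<sigma> t)\<^sup>2 + (beat_cos \<sigma> t)\<^sup>2 = 1"
proof -
  have "(beat_sin \<sigma> t)\<^sup>2 + (beat_cos \<sigma> t)\<^sup>2
      = ((sin (t powr \<alpha>))\<^sup>2 + (cos (t powr \<alpha>))\<^sup>2) * ((phase_cos t)\<^sup>2 + \<sigma>\<^sup>2 * (phase_sin t)\<^sup>2)"
    unfolding beat_sin_def beat_cos_def by algebra
  then show ?thesis using phase_circle assms by simp
qed

lemma abs_beat_sin_le: "0 < energy t \<Longrightarrow> \<sigma>\<^sup>2 = 1 \<Longrightarrow> \<bar>beat_sin \<sigma> t\<bar> \<le> 1"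
  using beat_circle[of t \<sigma>] by (simp add: abs_le_square_iff[of _ 1, simplified])
    (smt (verit) zero_le_power2)

lemma abs_beat_cos_le: "0 < energy t \<Longrightarrow> \<sigma>\<^sup>2 = 1 \<Longrightarrow> \<bar>beat_cos \<sigma> t\<bar> \<le> 1"
  using beat_circle[of t \<sigma>] by (simp add: abs_le_square_iff[of _ 1, simplified])
    (smt (verit) zero_le_power2)

lemma DERIV_beat_cos:
  assumes t: "t0 \<le> t" and e: "0 < energy t" and \<sigma>: "\<sigma>\<^sup>2 = 1"
  shows "(beat_cos \<sigma> has_real_derivative
    - (\<alpha> * t powr \<alpha> / t + \<sigma> * (2 * l + b t * phase_sin t)) * beat_sin \<sigma> t) (at t within {t0..})"
proof -
  have "0 < t" using t t0 by simp
  note d = DERIV_cos_powr_alpha[OF \<open>0 < t\<close>] DERIV_sin_powr_alpha[OF \<open>0 < t\<close>]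
    DERIV_phase_cos[OF t e] DERIV_phase_sin[OF t e]
  define w q where "w = \<alpha> * t powr \<alpha> / t" and "q = 2 * l + b t * phase_sin t"
  have "(beat_cos \<sigma> has_real_derivative
      (- sin (t powr \<alpha>) * w * phase_cos t + (- q * phase_sin t) * cos (t powr \<alpha>))
      - (\<sigma> * (cos (t powr \<alpha>) * w) * phase_sin t + q * phase_cos t * (\<sigma> * sin (t powr \<alpha>)))) (at t within {t0..})"
    unfolding beat_cos_def w_def q_def by (intro DERIV_diff DERIV_mult DERIV_cmult d)
  moreover have "(- sin (t powr \<alpha>) * w * phase_cos t + (- q * phase_sin t) * cos (t powr \<alpha>))
      - (\<sigma> * (cos (t powr \<alpha>) * w) * phase_sin t + q * phase_cos t * (\<sigma> * sin (t powr \<alpha>)))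
    = - (w + \<sigma> * q) * beat_sin \<sigma> t"
    using \<sigma> unfolding beat_sin_def by algebra
  ultimately show ?thesis unfolding w_def q_def by simp
qed

lemma continuous_on_beat_sin:
  assumes "t0 \<le> x" "\<And>s. s \<in> {x..y} \<Longrightarrow> 0 < energy s"
  shows "continuous_on {x..y} (beat_sin \<sigma>)"
  unfolding beat_sin_def using assms t0 by (intro continuous_intros continuous_on_phase) auto

text \<open>
  The reciprocal of \<open>t\<close> times \<open>\<alpha> t\<^bsup>\<alpha>-1\<^esup> + 2 \<sigma> l\<close>, the main part of the derivative of the phase
  \<open>t\<^sup>\<alpha> + \<sigma> \<phi>\<close>: the weight that multiplies the cosine when \<open>sin (t\<^sup>\<alpha> + \<sigma> \<phi>) / t\<close> is integrated by
  parts.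
\<close>

definition beat_weight :: "real \<Rightarrow> real \<Rightarrow> real" where
  "beat_weight \<sigma> t = 1 / (\<alpha> * t powr \<alpha> + 2 * \<sigma> * l * t)"

definition beat_weight' :: "real \<Rightarrow> real \<Rightarrow> real" where
  "beat_weight' \<sigma> t = - (\<alpha> * (\<alpha> * t powr \<alpha> / t) + 2 * \<sigma> * l) / (\<alpha> * t powr \<alpha> + 2 * \<sigma> * l * t)\<^sup>2"

lemma DERIV_beat_weight:
  assumes "0 < t" "\<alpha> * t powr \<alpha> + 2 * \<sigma> * l * t \<noteq> 0"
  shows "(beat_weight \<sigma> has_real_derivative beat_weight' \<sigma> t) (at t within S)"
proof -
  have d: "((\<lambda>s. \<alpha> * s powr \<alpha> + 2 * \<sigma> * l * s) has_real_derivative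
      \<alpha> * (\<alpha> * t powr \<alpha> / t) + 2 * \<sigma> * l * 1) (at t within S)"
    by (intro DERIV_add DERIV_cmult DERIV_ident DERIV_powr_alpha assms)
  show ?thesis
    using DERIV_divide[OF DERIV_const[of 1] d assms(2)]
    unfolding beat_weight_def beat_weight'_def by (simp add: power2_eq_square)
qed

text \<open>
  Non-stationary phase.  Let \<open>g\<close> be the weight, \<open>C\<close> the cosine and \<open>S\<close> the sine.  Then
  \<open>(g C)' = g' C - S / s - \<sigma> g b sin \<phi> S\<close>.  The last term is at most \<open>(a + r) K / s\<^sup>2\<close>.  In the first
  one, \<open>|g' C| \<le> |g'| \<le> - g' + m / s\<^sup>2\<close>, so that it is compensated by the derivative of \<open>- g\<close> when \<open>g\<close>
  decreases, and up to \<open>m\<close> when it does not; hence the factor \<open>C - 1\<close> in the result.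
\<close>

lemma integral_beat_le:
  assumes x: "t0 \<le> x" "x \<le> y" and e: "\<And>s. s \<in> {x..y} \<Longrightarrow> 0 < energy s"
    and \<sigma>: "\<sigma>\<^sup>2 = 1"
    and nz: "\<And>s. s \<in> {x..y} \<Longrightarrow> \<alpha> * s powr \<alpha> + 2 * \<sigma> * l * s \<noteq> 0"
    and K: "\<And>s. s \<in> {x..y} \<Longrightarrow> \<bar>beat_weight \<sigma> s\<bar> \<le> K / s"
    and m: "\<And>s. s \<in> {x..y} \<Longrightarrow> \<bar>beat_weight' \<sigma> s\<bar> \<le> - beat_weight' \<sigma> s + m / s\<^sup>2"
  shows "integral {x..y} (\<lambda>s. - beat_sin \<sigma> s / s)
    \<le> beat_weight \<sigma> y * (beat_cos \<sigma> y - 1) - beat_weight \<sigma> x * (beat_cos \<sigma> x - 1) + ((a + r) * K + m) * (1 / x - 1 / y)"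
proof -
  define P where "P s = beat_weight \<sigma> s * (beat_cos \<sigma> s - 1) - ((a + r) * K + m) * (1 / s)" for s
  define w where "w s = \<alpha> * s powr \<alpha> / s + \<sigma> * (2 * l + b s * phase_sin s)" for s
  define P' where "P' s = (beat_weight' \<sigma> s * (beat_cos \<sigma> s - 1) + (- w s * beat_sin \<sigma> s - 0) * beat_weight \<sigma> s)
    - ((a + r) * K + m) * (- 1 / s\<^sup>2)" for s
  have "integral {x..y} (\<lambda>s. - beat_sin \<sigma> s / s) \<le> P y - P x"
  proof (rule integral_le_of_derivative_ge[where S = "{t0..}" and P' = P'])
    fix s assume s: "s \<in> {x..y}"
    then have pos: "0 < s" "t0 \<le> s" using x t0 by auto
    have inv: "((\<lambda>s. 1 / s) has_real_derivative - 1 / s\<^sup>2) (at s within {t0..})"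
      using pos by (auto intro!: derivative_eq_intros simp: power2_eq_square)
    show "(P has_real_derivative P' s) (at s within {t0..})"
      unfolding P_def P'_def w_def
      by (intro DERIV_diff DERIV_mult DERIV_cmult DERIV_const DERIV_beat_weight DERIV_beat_cos inv
          nz[OF s] e[OF s] \<sigma> pos)
    have main: "(\<alpha> * s powr \<alpha> / s + \<sigma> * (2 * l)) * beat_weight \<sigma> s = 1 / s"
      unfolding beat_weight_def using nz[OF s] pos by (simp add: field_simps)
    have "- beat_weight \<sigma> s * (\<sigma> * b s * phase_sin s * beat_sin \<sigma> s) \<ge> - ((a + r) * K / s\<^sup>2)"
    proof -
      have "\<bar>\<sigma>\<bar> = 1" using \<sigma> by (simp add: power2_eq_1_iff) auto
      have "\<bar>beat_weight \<sigma> s * (\<sigma> * b s * phase_sin s * beat_sin \<sigma> s)\<bar> \<le> K / s * (1 * ((a + r) / s) * 1 * 1)"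
        unfolding abs_mult \<open>\<bar>\<sigma>\<bar> = 1\<close>
        by (intro mult_mono abs_b_le abs_phase_sin_le abs_beat_sin_le K \<sigma>)
          (use pos e s a r K[OF s] in auto)
      also have "\<dots> = (a + r) * K / s\<^sup>2" by (simp add: power2_eq_square)
      finally show ?thesis by linarith
    qed
    moreover have "- m / s\<^sup>2 \<le> beat_weight' \<sigma> s * (beat_cos \<sigma> s - 1)"
    proof -
      have "beat_weight' \<sigma> s * beat_cos \<sigma> s \<ge> - \<bar>beat_weight' \<sigma> s\<bar> * 1"
        using abs_beat_cos_le[OF e[OF s] \<sigma>] mult_left_mono[of "\<bar>beat_cos \<sigma> s\<bar>" 1 "\<bar>beat_weight' \<sigma> s\<bar>"]
        by (simp add: abs_mult[symmetric] abs_le_iff)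
      then show ?thesis using m[OF s] by (simp add: algebra_simps)
    qed
    moreover have "P' s = - beat_sin \<sigma> s * ((\<alpha> * s powr \<alpha> / s + \<sigma> * (2 * l)) * beat_weight \<sigma> s)
        + - beat_weight \<sigma> s * (\<sigma> * b s * phase_sin s * beat_sin \<sigma> s) + beat_weight' \<sigma> s * (beat_cos \<sigma> s - 1)
        + (a + r) * K / s\<^sup>2 + m / s\<^sup>2"
      unfolding P'_def w_def by (simp add: algebra_simps add_divide_distrib)
    ultimately show "- beat_sin \<sigma> s / s \<le> P' s"
      unfolding main by (simp add: algebra_simps)
  qed (use x t0 e in \<open>auto intro!: continuous_intros continuous_on_phase continuous_on_beat_sin\<close>)
  then show ?thesis unfolding P_def by (simp add: algebra_simps)
qed

text \<open>
  The hypothesis says that the main part of the phase speed is at least \<open>1 / K\<close>.  The weight is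
  then positive and decreasing, since \<open>t\<^sup>\<alpha>\<close> is convex, and \<open>integral_beat_le\<close> applies with \<open>m = 0\<close>.
\<close>

lemma integral_beat_decreasing_weight_le:
  assumes x: "t0 \<le> x" "x \<le> y" and e: "\<And>s. s \<in> {x..y} \<Longrightarrow> 0 < energy s"
    and \<sigma>: "\<sigma>\<^sup>2 = 1" and "0 \<le> K"
    and lower: "\<And>s. s \<in> {x..y} \<Longrightarrow> s \<le> K * (\<alpha> * s powr \<alpha> + 2 * \<sigma> * l * s)"
  shows "integral {x..y} (\<lambda>s. - beat_sin \<sigma> s / s) \<le> (a + r + 2) * K / x"
proof -
  have pos: "0 < s" if "s \<in> {x..y}" for s using that x t0 by auto
  have D: "0 < \<alpha> * s powr \<alpha> + 2 * \<sigma> * l * s" if "s \<in> {x..y}" for s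
    using lower[OF that] pos[OF that] \<open>0 \<le> K\<close>
    by (metis linorder_not_less mult_nonneg_nonpos order_less_le_trans)
  have weight: "0 < beat_weight \<sigma> s" "beat_weight \<sigma> s \<le> K / s" if "s \<in> {x..y}" for s
    using D[OF that] lower[OF that] pos[OF that] by (auto simp: beat_weight_def field_simps)
  have "beat_weight' \<sigma> s \<le> 0" if s: "s \<in> {x..y}" for s
  proof -
    have "\<alpha> * s powr \<alpha> / s \<le> \<alpha> * (\<alpha> * s powr \<alpha> / s)"
      using \<alpha> pos[OF s] by (intro mult_right_mono[of 1 \<alpha>, simplified]) auto
    moreover have "0 < \<alpha> * s powr \<alpha> / s + 2 * \<sigma> * l"
      using D[OF s] pos[OF s] by (simp add: field_simps)
    ultimately show ?thesis
      unfolding beat_weight'_def by (intro divide_nonpos_nonneg) auto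
  qed
  then have "integral {x..y} (\<lambda>s. - beat_sin \<sigma> s / s)
    \<le> beat_weight \<sigma> y * (beat_cos \<sigma> y - 1) - beat_weight \<sigma> x * (beat_cos \<sigma> x - 1)
      + ((a + r) * K + 0) * (1 / x - 1 / y)"
    using weight D by (intro integral_beat_le x e \<sigma>) (auto simp: less_imp_neq[symmetric] less_imp_le)
  moreover have "beat_weight \<sigma> y * (beat_cos \<sigma> y - 1) \<le> 0"
    using abs_beat_cos_le[OF e[of y] \<sigma>] weight(1)[of y] x by (intro mult_nonneg_nonpos) auto
  moreover have "- beat_weight \<sigma> x * (beat_cos \<sigma> x - 1) \<le> K / x * 2"
  proof -
    have "beat_weight \<sigma> x * (1 - beat_cos \<sigma> x) \<le> K / x * 2"
      using abs_beat_cos_le[OF e[of x] \<sigma>] weight[of x] x by (intro mult_mono) auto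
    then show ?thesis by (simp add: algebra_simps)
  qed
  moreover have "(a + r) * K * (1 / x - 1 / y) \<le> (a + r) * K * (1 / x)"
    using a r \<open>0 \<le> K\<close> x t0 by (intro mult_left_mono) auto
  ultimately have "integral {x..y} (\<lambda>s. - beat_sin \<sigma> s / s) \<le> K / x * 2 + (a + r) * K * (1 / x)"
    by simp
  also have "\<dots> = (a + r + 2) * K / x" by (simp add: add_divide_distrib algebra_simps)
  finally show ?thesis .
qed

text \<open>
  Before the resonance the main part of the speed of the phase \<open>t\<^sup>\<alpha> - \<phi>\<close> is at most \<open>- l\<close>, so the
  weight is negative.  It need not be monotone, but its derivative is at most \<open>1 / (l s\<^sup>2)\<close>, which is enough
  for \<open>integral_beat_le\<close> with \<open>m = 2 / l\<close>.
\<close>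

lemma integral_beat_before_resonance_le:
  assumes x: "t0 \<le> x" "x \<le> y" and e: "\<And>s. s \<in> {x..y} \<Longrightarrow> 0 < energy s"
    and "0 < l" and slow: "\<And>s. s \<in> {x..y} \<Longrightarrow> \<alpha> * s powr \<alpha> \<le> l * s"
  shows "integral {x..y} (\<lambda>s. - beat_sin (-1) s / s) \<le> (a + r + 2) / (l * x)"
proof -
  have pos: "0 < s" if "s \<in> {x..y}" for s using that x t0 by auto
  have D: "\<alpha> * s powr \<alpha> + 2 * (-1) * l * s \<le> - (l * s)" if "s \<in> {x..y}" for s
    using slow[OF that] by simp
  have ls: "0 < l * s" if "s \<in> {x..y}" for s using pos[OF that] \<open>0 < l\<close> by simp
  have weight_neg: "beat_weight (-1) s \<le> 0" if "s \<in> {x..y}" for s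
    unfolding beat_weight_def using D[OF that] ls[OF that] by (intro divide_nonneg_nonpos) auto
  have weight_le: "- beat_weight (-1) s \<le> (1 / l) / s" if "s \<in> {x..y}" for s
  proof -
    have "1 / - (\<alpha> * s powr \<alpha> + 2 * (-1) * l * s) \<le> 1 / (l * s)"
      using D[OF that] ls[OF that] by (intro divide_left_mono) auto
    then show ?thesis
      unfolding beat_weight_def by (simp only: minus_divide_right divide_divide_eq_left)
  qed
  have weight': "beat_weight' (-1) s \<le> (1 / l) / s\<^sup>2" if s: "s \<in> {x..y}" for s
  proof -
    define d where "d = - (\<alpha> * s powr \<alpha> + 2 * (-1) * l * s)"
    have d: "l * s \<le> d" using D[OF s] unfolding d_def by linarith
    have "\<alpha> * s powr \<alpha> / s \<le> \<alpha> * (\<alpha> * s powr \<alpha> / s)"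
      using \<alpha> pos[OF s] by (intro mult_right_mono[of 1 \<alpha>, simplified]) auto
    moreover have "d / s = - (\<alpha> * s powr \<alpha> / s + 2 * (-1) * l)"
      unfolding d_def using pos[OF s] by (simp add: field_simps)
    ultimately have "- (\<alpha> * (\<alpha> * s powr \<alpha> / s) + 2 * (-1) * l) \<le> d / s"
      by linarith
    then have "beat_weight' (-1) s \<le> (d / s) / d\<^sup>2"
      unfolding beat_weight'_def d_def power2_minus by (intro divide_right_mono) auto
    also have "\<dots> = (1 / d) / s" using d ls[OF s] by (simp add: power2_eq_square)
    also have "\<dots> \<le> (1 / (l * s)) / s"
      using d ls[OF s] pos[OF s] by (intro divide_right_mono divide_left_mono) auto
    finally show ?thesis by (simp add: power2_eq_square)
  qed
  have "integral {x..y} (\<lambda>s. - beat_sin (-1) s / s)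
    \<le> beat_weight (-1) y * (beat_cos (-1) y - 1) - beat_weight (-1) x * (beat_cos (-1) x - 1)
      + ((a + r) * (1 / l) + 2 * (1 / l)) * (1 / x - 1 / y)"
  proof (intro integral_beat_le x e)
    fix s assume s: "s \<in> {x..y}"
    show "\<alpha> * s powr \<alpha> + 2 * (-1) * l * s \<noteq> 0" using D[OF s] ls[OF s] by linarith
    show "\<bar>beat_weight (-1) s\<bar> \<le> (1 / l) / s" using weight_neg[OF s] weight_le[OF s] by linarith
    have "2 * (1 / l) / s\<^sup>2 = (1 / l) / s\<^sup>2 + (1 / l) / s\<^sup>2" by (simp add: field_simps)
    moreover have "0 \<le> (1 / l) / s\<^sup>2" using \<open>0 < l\<close> by simp
    ultimately show "\<bar>beat_weight' (-1) s\<bar> \<le> - beat_weight' (-1) s + 2 * (1 / l) / s\<^sup>2"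
      using weight'[OF s] by linarith
  qed auto
  moreover have "beat_weight (-1) y * (beat_cos (-1) y - 1) \<le> (1 / l) / y * 2"
  proof -
    have "- beat_weight (-1) y * (1 - beat_cos (-1) y) \<le> (1 / l) / y * 2"
      using abs_beat_cos_le[OF e[of y], of "-1"] weight_le[of y] weight_neg[of y] x \<open>0 < l\<close> pos[of y]
      by (intro mult_mono) auto
    then show ?thesis by (simp add: algebra_simps)
  qed
  moreover have "0 \<le> beat_weight (-1) x * (beat_cos (-1) x - 1)"
    using abs_beat_cos_le[OF e[of x], of "-1"] weight_neg[of x] x by (intro mult_nonpos_nonpos) auto
  \<comment> \<open>The boundary term \<open>2 / (l y)\<close> is cancelled by the contribution of \<open>m\<close> at \<open>y\<close>; what remains at \<open>y\<close> has the good sign.\<close>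
  moreover have "0 \<le> (a + r) * (1 / l) * (1 / y)"
    using a r \<open>0 < l\<close> x t0 by auto
  ultimately have "integral {x..y} (\<lambda>s. - beat_sin (-1) s / s)
      \<le> ((a + r) * (1 / l) + 2 * (1 / l)) * (1 / x)"
    by (simp add: algebra_simps)
  also have "\<dots> = (a + r + 2) / (l * x)" by (simp add: add_divide_distrib)
  finally show ?thesis .
qed

lemma frequency_le_below_threshold:
  assumes "0 < s" "s \<le> (k / \<alpha>) powr (1 / (\<alpha> - 1))" "0 < k"
  shows "\<alpha> * s powr \<alpha> \<le> k * s"
proof -
  have "s powr (\<alpha> - 1) \<le> ((k / \<alpha>) powr (1 / (\<alpha> - 1))) powr (\<alpha> - 1)"
    using assms \<alpha> by (intro powr_mono2) auto
  also have "\<dots> = k / \<alpha>" using assms \<alpha> by (simp add: powr_powr)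
  finally have "\<alpha> * s powr (\<alpha> - 1) * s \<le> k * s"
    using assms \<alpha> by (intro mult_right_mono) (auto simp: field_simps)
  then show ?thesis using assms by (simp add: powr_diff)
qed

lemma frequency_ge_above_threshold:
  assumes "0 < s" "(k / \<alpha>) powr (1 / (\<alpha> - 1)) \<le> s" "0 < k"
  shows "k * s \<le> \<alpha> * s powr \<alpha>"
proof -
  have "k / \<alpha> = ((k / \<alpha>) powr (1 / (\<alpha> - 1))) powr (\<alpha> - 1)"
    using assms \<alpha> by (simp add: powr_powr)
  also have "\<dots> \<le> s powr (\<alpha> - 1)"
    using assms \<alpha> by (intro powr_mono2) auto
  finally have "k * s \<le> \<alpha> * s powr (\<alpha> - 1) * s"
    using assms \<alpha> by (intro mult_right_mono) (auto simp: field_simps)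
  then show ?thesis using assms by (simp add: powr_diff)
qed

text \<open>
  The thresholds \<open>T1\<close> and \<open>T2\<close> are the times at which \<open>\<alpha> t\<^bsup>\<alpha>-1\<^esup>\<close> equals \<open>l\<close> and \<open>3 l\<close>.  Outside
  \<open>{T1..T2}\<close> the main part \<open>\<alpha> t\<^bsup>\<alpha>-1\<^esup> - 2 l\<close> of the phase speed has absolute value at least \<open>l\<close>; inside, the integrand is
  bounded by \<open>1 / s\<close>, whose integral is \<open>ln (T2 / T1)\<close>.
\<close>

lemma integral_difference_beat_le:
  assumes x: "t0 \<le> x" "x \<le> y" and e: "\<And>s. s \<in> {x..y} \<Longrightarrow> 0 < energy s" and "0 < l"
  shows "integral {x..y} (\<lambda>s. - beat_sin (-1) s / s) \<le> 2 * ((a + r + 2) / (l * x)) + ln 3 / (\<alpha> - 1)"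
proof -
  define T1 T2 where "T1 = (l / \<alpha>) powr (1 / (\<alpha> - 1))" and "T2 = (3 * l / \<alpha>) powr (1 / (\<alpha> - 1))"
  have T1: "0 < T1" unfolding T1_def using \<open>0 < l\<close> \<alpha> by simp
  have T2: "T2 = 3 powr (1 / (\<alpha> - 1)) * T1"
    unfolding T1_def T2_def using \<open>0 < l\<close> \<alpha> by (simp add: powr_mult[symmetric])
  have "1 \<le> (3::real) powr (1 / (\<alpha> - 1))" using \<alpha> by (intro ge_one_powr_ge_zero) auto
  then have "T1 \<le> T2" using T2 T1 by simp
  \<comment> \<open>The thresholds, clamped to \<open>{x..y}\<close>; some of the three pieces may be degenerate.\<close>
  define y1 y2 where "y1 = max x (min y T1)" and "y2 = max x (min y T2)"
  have ord: "x \<le> y1" "y1 \<le> y2" "y2 \<le> y" unfolding y1_def y2_def using x \<open>T1 \<le> T2\<close> by auto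
  let ?p = "\<lambda>s. - beat_sin (-1) s / s"
  have c: "continuous_on {x..y} ?p"
    using x t0 e by (intro continuous_intros continuous_on_phase continuous_on_beat_sin) auto
  have int: "?p integrable_on {u..w}" if "x \<le> u" "w \<le> y" for u w
    by (rule integrable_continuous_real, rule continuous_on_subset[OF c]) (use that in auto)
  have "integral {x..y1} ?p + integral {y1..y2} ?p = integral {x..y2} ?p"
    using ord by (intro Henstock_Kurzweil_Integration.integral_combine int) auto
  moreover have "integral {x..y2} ?p + integral {y2..y} ?p = integral {x..y} ?p"
    using ord by (intro Henstock_Kurzweil_Integration.integral_combine int) auto
  moreover have "integral {x..y1} ?p \<le> (a + r + 2) / (l * x)"
  proof (cases "x = y1")
    case True
    then show ?thesis using a r \<open>0 < l\<close> x t0 by simp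
  next
    case False
    then have "y1 \<le> T1" unfolding y1_def by auto
    then show ?thesis
      using ord x t0 e \<open>0 < l\<close> unfolding T1_def
      by (intro integral_beat_before_resonance_le frequency_le_below_threshold) auto
  qed
  moreover have "integral {y1..y2} ?p \<le> ln 3 / (\<alpha> - 1)"
  proof (cases "y1 = y2")
    case True
    then show ?thesis using \<alpha> by simp
  next
    case False
    then have *: "T1 \<le> y1" "y2 \<le> T2" "y1 \<le> y2" "0 < y1"
      using ord x t0 unfolding y1_def y2_def by auto
    have "integral {y1..y2} ?p \<le> ln y2 - ln y1"
    proof (rule integral_le_of_derivative_ge[where S = "{y1..y2}" and P = ln and P' = "\<lambda>s. 1 / s"])
      fix s assume s: "s \<in> {y1..y2}"
      then have "0 < s" "s \<in> {x..y}" using * ord by auto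
      then show "(ln has_real_derivative 1 / s) (at s within {y1..y2})"
        by (auto intro!: derivative_eq_intros)
      show "?p s \<le> 1 / s"
        using abs_beat_sin_le[OF e[OF \<open>s \<in> {x..y}\<close>], of "-1"] \<open>0 < s\<close>
        by (intro divide_right_mono) auto
    next
      show "continuous_on {y1..y2} ?p"
        by (rule continuous_on_subset[OF c]) (use ord in auto)
    qed (use ord in auto)
    also have "\<dots> \<le> ln T2 - ln T1"
      using * T1 \<open>T1 \<le> T2\<close> by (intro diff_mono) auto
    also have "\<dots> = ln 3 / (\<alpha> - 1)"
      unfolding T2 using T1 by (simp add: ln_mult ln_powr)
    finally show ?thesis .
  qed
  moreover have "integral {y2..y} ?p \<le> (a + r + 2) / (l * x)"
  proof (cases "y2 = y")
    case True
    then show ?thesis using a r \<open>0 < l\<close> x t0 by simp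
  next
    case False
    then have "T2 \<le> y2" using x unfolding y2_def by auto
    have "integral {y2..y} ?p \<le> (a + r + 2) * (1 / l) / y2"
    proof (rule integral_beat_decreasing_weight_le)
      fix s assume s: "s \<in> {y2..y}"
      then have "3 * l * s \<le> \<alpha> * s powr \<alpha>"
        using ord x t0 \<open>0 < l\<close> \<open>T2 \<le> y2\<close> unfolding T2_def by (intro frequency_ge_above_threshold) auto
      then show "s \<le> 1 / l * (\<alpha> * s powr \<alpha> + 2 * (- 1) * l * s)"
        using \<open>0 < l\<close> by (simp add: field_simps)
      show "0 < energy s" using e s ord by auto
    qed (use ord x \<open>0 < l\<close> in auto)
    also have "\<dots> \<le> (a + r + 2) * (1 / l) / x"
      using ord x t0 a r \<open>0 < l\<close> by (intro divide_left_mono) auto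
    finally show ?thesis by simp
  qed
  ultimately show ?thesis by linarith
qed

section \<open>High frequencies\<close>

lemma integral_oscillating_damping_le:
  assumes "t0 \<le> x" "x \<le> y"
  shows "integral {x..y} (\<lambda>s. - r * sin (s powr \<alpha>) / s) \<le> 2 * r / (\<alpha> * x powr \<alpha>)"
proof -
  have "integral {x..y} (\<lambda>s. - r * sin (s powr \<alpha>) / s) \<le> sine_majorant y - sine_majorant x"
  proof (rule integral_le_of_derivative_ge[where S = UNIV and P = sine_majorant
        and P' = sine_majorant'])
    fix s assume "s \<in> {x..y}"
    then have "0 < s" using assms t0 by auto
    then show "(sine_majorant has_real_derivative sine_majorant' s) (at s)"
      and "- r * sin (s powr \<alpha>) / s \<le> sine_majorant' s"
      by (rule DERIV_sine_majorant, rule sine_majorant'_ge)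
  qed (use assms t0 in \<open>auto intro!: continuous_intros\<close>)
  also have "\<dots> \<le> 2 * r / (\<alpha> * x powr \<alpha>)"
    using assms t0 by (intro sine_majorant_increment_le) auto
  finally show ?thesis .
qed

text \<open>
  Integrate \<open>(ln E)' = - b (1 + cos \<phi>)\<close> after splitting the right-hand side into \<open>- a/s\<close> and four
  oscillating terms.  The condition \<open>l x \<ge> 1/2\<close> turns the bounds proportional to \<open>1 / (l x)\<close> into
  constants.
\<close>

lemma high_frequency_energy_le:
  assumes x: "t0 \<le> x" "x \<le> y" and high: "1 / 2 \<le> l * x"
  shows "energy y \<le> energy x * (x / y) powr a *
    exp (a * (a + r + 2) + 5 * r * (a + r + 2) / 2 + 2 * r / (\<alpha> * x powr \<alpha>) + r * ln 3 / (\<alpha> - 1))"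
proof (cases "0 < energy y")
  case False
  then have "energy y \<le> 0" by simp
  also have "0 \<le> energy x * (x / y) powr a *
    exp (a * (a + r + 2) + 5 * r * (a + r + 2) / 2 + 2 * r / (\<alpha> * x powr \<alpha>) + r * ln 3 / (\<alpha> - 1))"
    using energy_nonneg by simp
  finally show ?thesis .
next
  case True
  \<comment> \<open>The energy is nonincreasing, so positivity at the end makes the phase defined throughout.\<close>
  have e: "0 < energy s" if "s \<in> {x..y}" for s
    using energy_antimono[of s y] True that x by auto
  have pos: "0 < x" "0 < y" using x t0 by auto
  have "0 < l" using high pos l by (cases "l = 0") auto
  have lx: "1 / (l * x) \<le> 2" using high by (simp add: field_simps)
  define I1 where "I1 = integral {x..y} (\<lambda>s. - r * sin (s powr \<alpha>) / s)"
  define I2 where "I2 = integral {x..y} (\<lambda>s. - phase_cos s / s)"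
  define I3 where "I3 = integral {x..y} (\<lambda>s. - beat_sin 1 s / s)"
  define I4 where "I4 = integral {x..y} (\<lambda>s. - beat_sin (-1) s / s)"
  have H0: "((\<lambda>s. 1 / s) has_integral ln y - ln x) {x..y}"
  proof (rule fundamental_theorem_of_calculus[OF x(2)])
    fix s assume "s \<in> {x..y}"
    then show "(ln has_vector_derivative 1 / s) (at s within {x..y})"
      using pos unfolding has_real_derivative_iff_has_vector_derivative[symmetric]
      by (auto intro!: derivative_eq_intros)
  qed
  have H1: "((\<lambda>s. - r * sin (s powr \<alpha>) / s) has_integral I1) {x..y}"
    unfolding I1_def using pos
    by (intro integrable_integral integrable_continuous_real continuous_intros) auto
  have H2: "((\<lambda>s. - phase_cos s / s) has_integral I2) {x..y}"
    unfolding I2_def using pos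
    by (intro integrable_integral integrable_continuous_real continuous_intros
        continuous_on_phase x e) auto
  have H: "((\<lambda>s. - beat_sin \<sigma> s / s) has_integral integral {x..y} (\<lambda>s. - beat_sin \<sigma> s / s)) {x..y}" for \<sigma>
    using pos
    by (intro integrable_integral integrable_continuous_real continuous_intros
        continuous_on_beat_sin x e) auto
  have R: "((\<lambda>s. - a * (1 / s) + - r * sin (s powr \<alpha>) / s + a * (- phase_cos s / s)
      + r / 2 * (- beat_sin 1 s / s) + r / 2 * (- beat_sin (-1) s / s))
    has_integral - a * (ln y - ln x) + I1 + a * I2 + r / 2 * I3 + r / 2 * I4) {x..y}"
    unfolding I3_def I4_def
    by (intro has_integral_add has_integral_mult_right H0 H1 H2 H)
  have L: "((\<lambda>s. - b s * (1 + phase_cos s)) has_integral ln (energy y) - ln (energy x)) {x..y}"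
  proof (rule fundamental_theorem_of_calculus[OF x(2)])
    fix s assume s: "s \<in> {x..y}"
    have "((\<lambda>s. ln (energy s)) has_real_derivative - b s * (1 + phase_cos s)) (at s within {x..y})"
      by (rule has_field_derivative_subset[OF DERIV_ln_energy]) (use s x e in auto)
    then show "((\<lambda>s. ln (energy s)) has_vector_derivative - b s * (1 + phase_cos s)) (at s within {x..y})"
      by (simp add: has_real_derivative_iff_has_vector_derivative)
  qed
  have eq: "- b s * (1 + phase_cos s) = - a * (1 / s) + - r * sin (s powr \<alpha>) / s + a * (- phase_cos s / s)
      + r / 2 * (- beat_sin 1 s / s) + r / 2 * (- beat_sin (-1) s / s)" if "s \<in> {x..y}" for s
    unfolding b_def beat_sin_def using that pos by (simp add: field_simps)
  have "ln (energy y) - ln (energy x)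
      = - a * (ln y - ln x) + I1 + a * I2 + r / 2 * I3 + r / 2 * I4"
    by (rule has_integral_unique[OF has_integral_eq[OF eq L] R])
  moreover have "I1 \<le> 2 * r / (\<alpha> * x powr \<alpha>)"
    unfolding I1_def by (rule integral_oscillating_damping_le[OF x])
  moreover have "a * I2 \<le> a * (a + r + 2)"
  proof -
    have "I2 \<le> (a + r + 2) / (2 * l * x)"
      unfolding I2_def by (rule integral_phase_cos_le[OF x e \<open>0 < l\<close>])
    also have "\<dots> = (a + r + 2) / 2 * (1 / (l * x))" by simp
    also have "\<dots> \<le> (a + r + 2) / 2 * 2" using lx a r by (intro mult_left_mono) auto
    finally show ?thesis using a by simp
  qed
  moreover have "r / 2 * I3 \<le> r / 2 * (a + r + 2)"
  proof -
    have "I3 \<le> (a + r + 2) * (1 / (2 * l)) / x"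
      unfolding I3_def
    proof (rule integral_beat_decreasing_weight_le[OF x e])
      fix s assume "s \<in> {x..y}"
      then show "s \<le> 1 / (2 * l) * (\<alpha> * s powr \<alpha> + 2 * 1 * l * s)"
        using \<open>0 < l\<close> \<alpha> by (simp add: field_simps)
    qed (use \<open>0 < l\<close> in auto)
    also have "\<dots> = (a + r + 2) / 2 * (1 / (l * x))" by simp
    also have "\<dots> \<le> (a + r + 2) / 2 * 2" using lx a r by (intro mult_left_mono) auto
    finally show ?thesis using r by (intro mult_left_mono) auto
  qed
  moreover have "r / 2 * I4 \<le> 2 * r * (a + r + 2) + r * ln 3 / (\<alpha> - 1)"
  proof -
    define L where "L = ln 3 / (\<alpha> - 1)"
    have "I4 \<le> 2 * ((a + r + 2) * (1 / (l * x))) + L"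
      unfolding I4_def L_def using integral_difference_beat_le[OF x e \<open>0 < l\<close>] by simp
    also have "\<dots> \<le> 2 * ((a + r + 2) * 2) + L"
      using lx a r by (intro add_right_mono mult_left_mono) auto
    finally have "r / 2 * I4 \<le> r / 2 * (2 * ((a + r + 2) * 2) + L)"
      using r by (intro mult_left_mono) auto
    also have "\<dots> = 2 * r * (a + r + 2) + r * L / 2" by (simp add: algebra_simps)
    also have "\<dots> \<le> 2 * r * (a + r + 2) + r * L"
    proof -
      have "0 \<le> L" unfolding L_def using \<alpha> by simp
      then have "0 \<le> r * L" using r by simp
      then show ?thesis by linarith
    qed
    finally show ?thesis by (simp add: L_def)
  qed
  moreover have "a * ln (x / y) = - a * (ln y - ln x)"
    using pos by (simp add: ln_div algebra_simps)
  moreover have "5 * r * (a + r + 2) / 2 = r / 2 * (a + r + 2) + 2 * r * (a + r + 2)"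
    by simp
  ultimately have "ln (energy y) \<le> ln (energy x) + a * ln (x / y)
      + (a * (a + r + 2) + 5 * r * (a + r + 2) / 2 + 2 * r / (\<alpha> * x powr \<alpha>) + r * ln 3 / (\<alpha> - 1))"
    by linarith
  then have "exp (ln (energy y)) \<le> exp (ln (energy x)) * exp (a * ln (x / y))
      * exp (a * (a + r + 2) + 5 * r * (a + r + 2) / 2 + 2 * r / (\<alpha> * x powr \<alpha>) + r * ln 3 / (\<alpha> - 1))"
    unfolding exp_add[symmetric] by simp
  then show ?thesis using e[of x] e[of y] pos x by (simp add: powr_def)
qed

section \<open>Decay of all modes and of the solution\<close>

text \<open>
  The two regimes are joined at \<open>x = max t0 (1 / (2 l))\<close>, the first time with \<open>l x \<ge> 1/2\<close>.  If it
  is later than \<open>t0\<close>, the low-frequency bound holds up to \<open>x\<close>.  The summand \<open>l\<^sup>2 (v t0)\<^sup>2\<close> is needed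
  for the modes that oscillate from the start.
\<close>

lemma mode_energy_le:
  assumes t: "t0 \<le> t" and \<mu>: "\<mu> = min a 2" and B: "B = 3 * r / (\<alpha> * t0 powr \<alpha>)"
  shows "energy t \<le> exp (a * (a + r + 8) + 5 * r * (a + r + 4) / 2
        + 3 * r / (\<alpha> * t0 powr \<alpha>) + r * ln 3 / (\<alpha> - 1))
    * (4 * exp (2 * B) * (v' t0)\<^sup>2 + l\<^sup>2 * (v t0)\<^sup>2 + 2 / t0\<^sup>2 * (v t0)\<^sup>2) * (t0 / t) powr \<mu>"
proof -
  define N where "N = 4 * exp (2 * B) * (v' t0)\<^sup>2 + l\<^sup>2 * (v t0)\<^sup>2 + 2 / t0\<^sup>2 * (v t0)\<^sup>2"
  define \<Gamma> where "\<Gamma> = exp (a * (a + r + 8) + 5 * r * (a + r + 4) / 2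
        + 3 * r / (\<alpha> * t0 powr \<alpha>) + r * ln 3 / (\<alpha> - 1))"
  have N0: "0 \<le> N" unfolding N_def by simp
  have \<mu>': "\<mu> \<le> a" using \<mu> by simp
  have q0: "0 \<le> r / (\<alpha> * t0 powr \<alpha>)" using r \<alpha> by simp
  have \<Gamma>1: "1 \<le> \<Gamma>" unfolding \<Gamma>_def using a r \<alpha> q0 by simp
  have low: "energy s \<le> N * (t0 / s) powr \<mu>" if "t0 \<le> s" "l * s \<le> 1/2" for s
  proof -
    have "exp (4 * r / (\<alpha> * t0 powr \<alpha>)) \<le> exp (2 * B)"
      unfolding B using q0 by simp
    then have "4 * exp (4 * r / (\<alpha> * t0 powr \<alpha>)) * (v' t0)\<^sup>2 + 2 / t0\<^sup>2 * (v t0)\<^sup>2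
        \<le> 4 * exp (2 * B) * (v' t0)\<^sup>2 + 2 / t0\<^sup>2 * (v t0)\<^sup>2"
      by (intro add_right_mono mult_right_mono mult_left_mono) auto
    also have "\<dots> \<le> N" unfolding N_def by simp
    finally show ?thesis
      using low_frequency_energy_le[OF that \<mu>] by (meson mult_right_mono order_trans powr_ge_zero)
  qed
  show ?thesis
  proof (cases "l * t \<le> 1/2")
    case True
    have "N * (t0 / t) powr \<mu> \<le> \<Gamma> * N * (t0 / t) powr \<mu>"
      using \<Gamma>1 N0 by (intro mult_right_mono) (auto intro: mult_right_mono[of 1 \<Gamma> N, simplified])
    then show ?thesis using low[OF t True] unfolding N_def \<Gamma>_def by linarith
  next
    case False
    then have "0 < l" using l by (cases "l = 0") auto
    define x where "x = max t0 (1 / (2 * l))"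
    have x: "t0 \<le> x" "x \<le> t" "1 / 2 \<le> l * x" "0 < x"
      unfolding x_def using False \<open>0 < l\<close> t t0 by (auto simp: field_simps max_def)
    have start: "energy x \<le> N * (t0 / x) powr \<mu>"
    proof (cases "x = t0")
      case True
      have "0 \<le> B" using q0 unfolding B by simp
      then have "1 \<le> exp (2 * B)" by simp
      then have "1 * (v' t0)\<^sup>2 \<le> 4 * exp (2 * B) * (v' t0)\<^sup>2"
        by (intro mult_right_mono) (linarith, simp)
      moreover have "0 \<le> 2 / t0\<^sup>2 * (v t0)\<^sup>2" by simp
      ultimately have "energy t0 \<le> N" unfolding energy_def N_def by linarith
      then show ?thesis unfolding True using t0 by simp
    next
      case False
      then have "l * x \<le> 1/2" unfolding x_def using \<open>0 < l\<close> by (auto simp: max_def split: if_splits)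
      then show ?thesis using low x by simp
    qed
    let ?K = "a * (a + r + 2) + 5 * r * (a + r + 2) / 2 + 2 * r / (\<alpha> * x powr \<alpha>) + r * ln 3 / (\<alpha> - 1)"
    have "2 * r / (\<alpha> * x powr \<alpha>) \<le> 2 * r / (\<alpha> * t0 powr \<alpha>)"
      using x t0 r \<alpha> by (intro divide_left_mono mult_left_mono powr_mono2) auto
    also have "\<dots> \<le> 3 * r / (\<alpha> * t0 powr \<alpha>)" using q0 by simp
    finally have q: "2 * r / (\<alpha> * x powr \<alpha>) \<le> 3 * r / (\<alpha> * t0 powr \<alpha>)" .
    have "a * (a + r + 2) \<le> a * (a + r + 8)" "5 * r * (a + r + 2) / 2 \<le> 5 * r * (a + r + 4) / 2"
      using a r by (auto intro!: mult_left_mono divide_right_mono)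
    with q have K: "exp ?K \<le> \<Gamma>" unfolding \<Gamma>_def by simp
    have "energy t \<le> energy x * (x / t) powr a * exp ?K"
      by (rule high_frequency_energy_le[OF x(1-3)])
    also have "\<dots> \<le> (N * (t0 / x) powr \<mu>) * (x / t) powr \<mu> * \<Gamma>"
      using start x t0 \<mu>' K N0 \<Gamma>1 energy_nonneg by (intro mult_mono powr_mono') auto
    also have "\<dots> = \<Gamma> * N * ((t0 / x) * (x / t)) powr \<mu>"
      by (simp only: powr_mult mult_ac)
    also have "(t0 / x) * (x / t) = t0 / t" using x by simp
    finally show ?thesis unfolding N_def \<Gamma>_def .
  qed
qed

end

text \<open>
  The candidate for the derivative has to be a vector, so \<open>w' t\<close> must first be shown to agree almost
  everywhere with a measurable function: the limit of the difference quotients of the transforms along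
  one sequence.  The difference quotients and \<open>w' t\<close> are bounded by \<open>\<surd>G\<close>, hence the squared errors by
  \<open>4 G\<close>, and dominated convergence together with the isometry gives convergence in norm.
\<close>

lemma (in mult_operator) has_vector_derivative_of_transform:
  assumes S: "S = {t0..}" and t: "t \<in> S"
    and repr: "\<And>s. s \<in> S \<Longrightarrow> AE x in M. F (u s) x = w s x"
    and deriv: "\<And>x s. x \<in> space M \<Longrightarrow> s \<in> S \<Longrightarrow>
      ((\<lambda>s. w s x) has_real_derivative w' s x) (at s within S)"
    and G: "integrable M G"
    and bound: "\<And>x s. x \<in> space M \<Longrightarrow> s \<in> S \<Longrightarrow> (w' s x)\<^sup>2 \<le> G x"
  obtains z where "(u has_vector_derivative z) (at t within S)" "AE x in M. F z x = w' t x"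
proof -
  have F_meas: "F v \<in> borel_measurable M" for v
    using F_L2[of v] by (simp add: L2_fun_def)
  have quotient: "(\<lambda>i. (w (X i) x - w t x) / (X i - t)) \<longlonglongrightarrow> w' t x"
    if "x \<in> space M" "\<And>i. X i \<in> S - {t}" "X \<longlonglongrightarrow> t" for x and X :: "nat \<Rightarrow> real"
  proof -
    have "((\<lambda>s. (w s x - w t x) / (s - t)) \<longlongrightarrow> w' t x) (at t within S)"
      using deriv[OF that(1) t] by (simp add: has_field_derivative_iff)
    then show ?thesis
      using that unfolding tendsto_at_iff_sequentially comp_def by blast
  qed
  define X0 :: "nat \<Rightarrow> real" where "X0 n = t + inverse (real (Suc n))" for n
  have X0: "X0 n \<in> S - {t}" for n
  proof -
    have "0 < inverse (real (Suc n))" by simp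
    then show ?thesis using t unfolding S X0_def by (simp del: of_nat_Suc inverse_positive_iff_positive)
  qed
  have X0_lim: "X0 \<longlonglongrightarrow> t"
    unfolding X0_def using LIMSEQ_inverse_real_of_nat_add[of t] .
  define g where "g x = lim (\<lambda>n. (F (u (X0 n)) x - F (u t) x) / (X0 n - t))" for x
  have g_meas: "g \<in> borel_measurable M"
    unfolding g_def by (intro borel_measurable_lim_metric borel_measurable_divide
        borel_measurable_diff F_meas) auto
  have "AE x in M. \<forall>n. F (u (X0 n)) x = w (X0 n) x"
    using repr X0 by (auto simp: AE_all_countable)
  then have g: "AE x in M. g x = w' t x"
    using repr[OF t] AE_space
  proof eventually_elim
    case (elim x)
    then show ?case
      unfolding g_def using limI[OF quotient[OF elim(3) X0 X0_lim]] by simp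
  qed
  have "AE x in M. norm ((g x)\<^sup>2) \<le> G x"
    using g AE_space by eventually_elim (use bound t in simp)
  then have "integrable M (\<lambda>x. (g x)\<^sup>2)"
    by (intro Bochner_Integration.integrable_bound[OF G]) (use g_meas in auto)
  then have "g \<in> L2_fun M" using g_meas by (simp add: L2_fun_def)
  from F_surj[OF this] obtain z where z: "AE x in M. F z x = g x" by blast
  with g have Fz: "AE x in M. F z x = w' t x" by eventually_elim simp
  have "(u has_vector_derivative z) (at t within S)"
    unfolding has_vector_derivative_def has_derivative_iff_norm
  proof (intro conjI)
    show "((\<lambda>s. norm (u s - u t - (s - t) *\<^sub>R z) / norm (s - t)) \<longlongrightarrow> 0) (at t within S)"
      unfolding tendsto_at_iff_sequentially comp_def
    proof (intro allI impI)
      fix X assume X: "\<forall>i. X i \<in> S - {t}" "X \<longlonglongrightarrow> t"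
      \<comment> \<open>The error of the \<open>i\<close>-th difference quotient, written with the operations that \<open>F\<close> respects.\<close>
      define d where "d i = inverse (X i - t) *\<^sub>R (u (X i) + (-1) *\<^sub>R (u t + (X i - t) *\<^sub>R z))" for i
      have d_norm: "norm (u (X i) - u t - (X i - t) *\<^sub>R z) / norm (X i - t) = sqrt (\<integral>x. (F (d i) x)\<^sup>2 \<partial>M)" for i
      proof -
        have "d i = inverse (X i - t) *\<^sub>R (u (X i) - u t - (X i - t) *\<^sub>R z)"
          unfolding d_def by (simp add: diff_diff_eq)
        then have "norm (u (X i) - u t - (X i - t) *\<^sub>R z) / norm (X i - t) = norm (d i)"
          by (simp only: norm_scaleR) (simp add: divide_inverse mult.commute)
        then show ?thesis by (simp add: F_isometry[symmetric])
      qed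
      have d_eq: "AE x in M. F (d i) x = (w (X i) x - w t x) / (X i - t) - w' t x" for i
      proof -
        have "X i \<in> S" "X i \<noteq> t" using X by auto
        show ?thesis
          using F_scale[of "inverse (X i - t)" "u (X i) + (-1) *\<^sub>R (u t + (X i - t) *\<^sub>R z)"]
            F_add[of "u (X i)" "(-1) *\<^sub>R (u t + (X i - t) *\<^sub>R z)"]
            F_scale[of "-1" "u t + (X i - t) *\<^sub>R z"]
            F_add[of "u t" "(X i - t) *\<^sub>R z"] F_scale[of "X i - t" z]
            repr[OF \<open>X i \<in> S\<close>] repr[OF t] Fz
          by eventually_elim (use \<open>X i \<noteq> t\<close> in \<open>simp add: d_def field_simps\<close>)
      qed
      have "(\<lambda>i. \<integral>x. (F (d i) x)\<^sup>2 \<partial>M) \<longlonglongrightarrow> (\<integral>x. 0 \<partial>M)"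
      proof (rule integral_dominated_convergence[where w = "\<lambda>x. 4 * G x"])
        have "AE x in M. \<forall>i. F (d i) x = (w (X i) x - w t x) / (X i - t) - w' t x"
          using d_eq by (simp add: AE_all_countable)
        then show "AE x in M. (\<lambda>i. (F (d i) x)\<^sup>2) \<longlonglongrightarrow> 0"
          using AE_space
        proof eventually_elim
          case (elim x)
          have "(\<lambda>i. ((w (X i) x - w t x) / (X i - t) - w' t x)\<^sup>2) \<longlonglongrightarrow> (w' t x - w' t x)\<^sup>2"
            using X by (intro tendsto_intros quotient elim) auto
          then show ?case using elim by simp
        qed
        show "AE x in M. norm ((F (d i) x)\<^sup>2) \<le> 4 * G x" for i
          using d_eq[of i] AE_space
        proof eventually_elim
          case (elim x)
          have Xi: "X i \<in> S" "X i \<noteq> t" using X by auto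
          have "norm (w' s x) \<le> sqrt (G x)" if "s \<in> S" for s
            using bound[OF elim(2) that] by (simp add: real_le_rsqrt)
          then have "norm (w (X i) x - w t x) \<le> sqrt (G x) * norm (X i - t)"
            using t Xi by (intro field_differentiable_bound[OF _ deriv[OF elim(2)]]) (auto simp: S)
          then have "\<bar>(w (X i) x - w t x) / (X i - t)\<bar> \<le> sqrt (G x)"
            using Xi by (simp add: field_simps)
          moreover have "\<bar>w' t x\<bar> \<le> sqrt (G x)"
            using bound[OF elim(2) t] by (intro real_le_rsqrt) simp
          ultimately have "\<bar>F (d i) x\<bar> \<le> 2 * sqrt (G x)"
            unfolding elim(1) by linarith
          then have "(F (d i) x)\<^sup>2 \<le> (2 * sqrt (G x))\<^sup>2"
            using power_mono[of "\<bar>F (d i) x\<bar>" "2 * sqrt (G x)" 2] by simp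
          moreover have "0 \<le> G x" using bound[OF elim(2) t] zero_le_power2 order_trans by blast
          ultimately show ?case by (simp add: power_mult_distrib)
        qed
      qed (use G F_meas in auto)
      then have "(\<lambda>i. sqrt (\<integral>x. (F (d i) x)\<^sup>2 \<partial>M)) \<longlonglongrightarrow> sqrt 0"
        by (intro tendsto_real_sqrt) simp
      then show "(\<lambda>i. norm (u (X i) - u t - (X i - t) *\<^sub>R z) / norm (X i - t)) \<longlonglongrightarrow> 0"
        unfolding d_norm by simp
    qed
  qed (rule bounded_linear_scaleR_left)
  then show thesis using Fz that by blast
qed

theorem theorem2p4:
  fixes D :: "'h::{real_inner, complete_space} set"
    and A :: "'h \<Rightarrow> 'h"
    and M :: "'m measure"
    and lam :: "'m \<Rightarrow> real"
    and F :: "'h \<Rightarrow> 'm \<Rightarrow> real"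
    and t0 a r \<alpha> \<mu> B \<Gamma>2 :: real
    and b :: "real \<Rightarrow> real"
    and u0 u1 :: 'h
    and u :: "real \<Rightarrow> 'h"
  assumes "mult_operator D A M lam F"
    and "t0 > 0"
    and "a > 0" and "0 \<le> r" and "r \<le> a" and "\<alpha> > 1"
    and "\<And>t. t > 0 \<Longrightarrow> b t = (a + r * sin (t powr \<alpha>)) / t"
    and "\<mu> = min a 2"
    and "B = 3 * r / (\<alpha> * t0 powr \<alpha>)"
    and "\<Gamma>2 = exp (a * (a + r + 8) + 5 * r * (a + r + 4) / 2
                  + 3 * r / (\<alpha> * t0 powr \<alpha>) + r * ln 3 / (\<alpha> - 1))"
    and "u0 \<in> pow_dom M lam F (1/2)"
    and "evolution_solution M lam F b t0 u0 u1 u"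
  shows "\<forall>t\<ge>t0.
    u differentiable (at t within {t0..}) \<and>
    u t \<in> pow_dom M lam F (1/2) \<and>
    (norm (vector_derivative u (at t within {t0..})))\<^sup>2 + (norm (op_pow M lam F (1/2) (u t)))\<^sup>2
      \<le> \<Gamma>2 * (4 * exp (2 * B) * (norm u1)\<^sup>2 + (norm (op_pow M lam F (1/2) u0))\<^sup>2
              + 2 / t0\<^sup>2 * (norm u0)\<^sup>2) * (t0 / t) powr \<mu>"
proof (intro allI impI)
  fix t assume t: "t0 \<le> t"
  interpret mult_operator D A M lam F by fact
  interpret oscillating_damping t0 a r \<alpha> using assms by unfold_locales auto
  obtain w w' where
    ode: "\<And>x. x \<in> space M \<Longrightarrow>
      ode_solution b (lam x) t0 (F u0 x) (F u1 x) (\<lambda>t. w t x) (\<lambda>t. w' t x)"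
    and repr: "\<And>t. t0 \<le> t \<Longrightarrow> AE x in M. F (u t) x = w t x"
    using assms(12) unfolding evolution_solution_def by blast
  have mode: "damped_mode t0 a r \<alpha> (lam x) (\<lambda>t. w t x) (\<lambda>t. w' t x)" if x: "x \<in> space M" for x
  proof
    fix s assume s: "t0 \<le> s"
    then have "oscillating_damping.b a r \<alpha> s = b s"
      using assms(7)[of s] t0 by (simp add: b_def)
    moreover obtain v'' where v'': "((\<lambda>t. w' t x) has_real_derivative v'') (at s within {t0..})"
      "v'' + b s * w' s x + (lam x)\<^sup>2 * w s x = 0"
      using ode[OF x] s unfolding ode_solution_def by blast
    ultimately have "v'' = - (oscillating_damping.b a r \<alpha> s * w' s x + (lam x)\<^sup>2 * w s x)" by simp
    with v'' show "((\<lambda>t. w' t x) has_real_derivative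
        - (oscillating_damping.b a r \<alpha> s * w' s x + (lam x)\<^sup>2 * w s x)) (at s within {t0..})"
      by simp
    show "((\<lambda>t. w t x) has_real_derivative w' s x) (at s within {t0..})"
      using ode[OF x] s unfolding ode_solution_def by blast
  qed (use lam_nonneg x in auto)
  have init: "w t0 x = F u0 x" "w' t0 x = F u1 x" if "x \<in> space M" for x
    using ode[OF that] unfolding ode_solution_def by auto
  have lam_powr: "lam x powr (4 * (1/2)) = (lam x)\<^sup>2" if "x \<in> space M" for x
    using lam_nonneg[OF that] by simp
  have F_meas: "F v \<in> borel_measurable M" and F_int: "integrable M (\<lambda>x. (F v x)\<^sup>2)" for v
    using F_L2[of v] by (auto simp: L2_fun_def)
  have u0_int: "integrable M (\<lambda>x. lam x powr (4 * (1/2)) * (F u0 x)\<^sup>2)"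
    using assms(11) by (simp only: pow_dom_def mem_Collect_eq)
  define G where "G x = (F u1 x)\<^sup>2 + lam x powr (4 * (1/2)) * (F u0 x)\<^sup>2" for x
  have G_int: "integrable M G"
    unfolding G_def by (intro Bochner_Integration.integrable_add F_int u0_int)
  have energy_le: "(w' s x)\<^sup>2 + (lam x)\<^sup>2 * (w s x)\<^sup>2 \<le> G x" if "x \<in> space M" "t0 \<le> s" for x s
    using damped_mode.energy_antimono[OF mode[OF that(1)] order_refl that(2)]
    unfolding damped_mode.energy_def[OF mode[OF that(1)]] G_def lam_powr[OF that(1)]
      init[OF that(1)] .
  have deriv: "((\<lambda>s. w s x) has_real_derivative w' s x) (at s within {t0..})"
    if "x \<in> space M" "s \<in> {t0..}" for x s
    using damped_mode.v_deriv[OF mode[OF that(1)]] that(2) by simp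
  have velocity_le: "(w' s x)\<^sup>2 \<le> G x" if "x \<in> space M" "s \<in> {t0..}" for x s
    using energy_le[OF that(1), of s] that(2) by (smt (verit) atLeast_iff zero_le_mult_iff zero_le_power2)
  obtain z where z: "(u has_vector_derivative z) (at t within {t0..})" "AE x in M. F z x = w' t x"
    by (rule has_vector_derivative_of_transform[OF refl _ _ deriv G_int velocity_le, of t u])
      (use t repr in auto)
  have "integrable M (\<lambda>x. lam x powr (4 * (1/2)) * (F (u t) x)\<^sup>2)"
  proof (rule Bochner_Integration.integrable_bound[OF G_int])
    show "(\<lambda>x. lam x powr (4 * (1/2)) * (F (u t) x)\<^sup>2) \<in> borel_measurable M"
      using lam_measurable F_meas by simp
    show "AE x in M. norm (lam x powr (4 * (1/2)) * (F (u t) x)\<^sup>2) \<le> norm (G x)"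
      using repr[OF t] AE_space
    proof eventually_elim
      case (elim x)
      then show ?case
        using energy_le[OF elim(2) t] unfolding lam_powr[OF elim(2)]
        by (simp add: abs_mult) (smt (verit) zero_le_power2)
    qed
  qed
  then have ut: "u t \<in> pow_dom M lam F (1/2)"
    by (simp only: pow_dom_def mem_Collect_eq)
  have "at_right t \<le> at t within {t0..}"
    using t by (intro at_le) auto
  then have "at t within {t0..} \<noteq> bot"
    using trivial_limit_at_right_real[of t] by (metis bot.extremum_uniqueI)
  then have "vector_derivative u (at t within {t0..}) = z"
    by (rule vector_derivative_within[OF _ z(1)])
  then have "(norm (vector_derivative u (at t within {t0..})))\<^sup>2 + (norm (op_pow M lam F (1/2) (u t)))\<^sup>2
      = (\<integral>x. (F z x)\<^sup>2 + lam x powr (4 * (1/2)) * (F (u t) x)\<^sup>2 \<partial>M)"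
    using F_int[of z] ut unfolding norm_op_pow[OF ut]
    by (simp add: F_isometry pow_dom_def)
  also have "\<dots> \<le> (\<integral>x. \<Gamma>2 * (4 * exp (2 * B) * (F u1 x)\<^sup>2 + lam x powr (4 * (1/2)) * (F u0 x)\<^sup>2
      + 2 / t0\<^sup>2 * (F u0 x)\<^sup>2) * (t0 / t) powr \<mu> \<partial>M)"
  proof (rule integral_mono_AE)
    show "integrable M (\<lambda>x. (F z x)\<^sup>2 + lam x powr (4 * (1/2)) * (F (u t) x)\<^sup>2)"
      using F_int[of z] ut by (simp add: pow_dom_def)
    show "integrable M (\<lambda>x. \<Gamma>2 * (4 * exp (2 * B) * (F u1 x)\<^sup>2 + lam x powr (4 * (1/2)) * (F u0 x)\<^sup>2
      + 2 / t0\<^sup>2 * (F u0 x)\<^sup>2) * (t0 / t) powr \<mu>)"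
      using F_int[of u1] F_int[of u0] u0_int by simp
    show "AE x in M. (F z x)\<^sup>2 + lam x powr (4 * (1/2)) * (F (u t) x)\<^sup>2
      \<le> \<Gamma>2 * (4 * exp (2 * B) * (F u1 x)\<^sup>2 + lam x powr (4 * (1/2)) * (F u0 x)\<^sup>2
      + 2 / t0\<^sup>2 * (F u0 x)\<^sup>2) * (t0 / t) powr \<mu>"
      using repr[OF t] z(2) AE_space
    proof eventually_elim
      case (elim x)
      show ?case
        using damped_mode.mode_energy_le[OF mode[OF elim(3)] t assms(8,9)]
        unfolding damped_mode.energy_def[OF mode[OF elim(3)]] lam_powr[OF elim(3)]
          elim(1,2) init[OF elim(3)] assms(10) .
    qed
  qed
  also have "\<dots> = \<Gamma>2 * (4 * exp (2 * B) * (norm u1)\<^sup>2 + (norm (op_pow M lam F (1/2) u0))\<^sup>2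
              + 2 / t0\<^sup>2 * (norm u0)\<^sup>2) * (t0 / t) powr \<mu>"
    using F_int[of u1] F_int[of u0] u0_int 
    unfolding norm_op_pow[OF assms(11)] F_isometry[of u0] F_isometry[of u1] by simp
  finally show "u differentiable (at t within {t0..}) \<and> u t \<in> pow_dom M lam F (1/2) \<and>
    (norm (vector_derivative u (at t within {t0..})))\<^sup>2 + (norm (op_pow M lam F (1/2) (u t)))\<^sup>2
      \<le> \<Gamma>2 * (4 * exp (2 * B) * (norm u1)\<^sup>2 + (norm (op_pow M lam F (1/2) u0))\<^sup>2
              + 2 / t0\<^sup>2 * (norm u0)\<^sup>2) * (t0 / t) powr \<mu>"
    using ut z(1) by (auto intro: differentiableI_vector)
qed

end
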